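(* Let $0<\beta<1$, $k_n=\lfloor\exp(2^{\beta n})\rfloor$, and assume these satisfy $k_{n-1}\le k_n\le k_{n-1}^2$ for all $n\ge1$. Let $\mu$ be the stationary mean of the RHA process with these perplexities and $F=\mu(\cdot|\mathcal I)$ its random ergodic measure. Let $C$ be any uniquely decodable binary code for blocks, i.e. for each $m$ an injective map $C:\{1,\dots,k_0\}^m\to\{0,1\}^*$ whose image is uniquely decodable, with length $|C(\cdot)|$. Then $$\mathbb E_\mu\frac{\mathbb E_F|C(\xi_{1:m})|}{H_F(m)}=\Omega\Big(\frac{m^{1-\beta}}{(\log m)^{1/\beta-1}}\Big)\quad (m\to\infty).$$
   Context: Random hierarchical association (RHA) process. Fix positive integers $(k_n)_{n\ge0}$ (perplexities) with $k_{n-1}\le k_n\le k_{n-1}^2$ for all $n\ge1$. On a probability space $(\Omega,\mathcal J,P)$ let, for each $n\ge1$, $(L_{nj},R_{nj})_{j=1}^{k_n}$ be the lexicographically sorted enumeration of a uniformly random $k_n$-element subset of $\{1,\dots,k_{n-1}\}^2$ (each of the $\binom{k_{n-1}^2}{k_n}$ subsets equally likely), independently over $n$. Let $(C_n)_{n\ge0}$ be independent, independent of all $(L_{nj},R_{nj})$, with $C_n$ uniform on $\{1,\dots,k_n\}$. Define strings $Y^0_j=j$ (length 1) for $1\le j\le k_0$ and $Y^n_j=Y^{n-1}_{L_{nj}}Y^{n-1}_{R_{nj}}$ (concatenation). The RHA process is $\mathcal X=Y^0_{C_0}Y^1_{C_1}Y^2_{C_2}\cdots=X_1X_2X_3\cdots$,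 $X_{k:l}=X_k\cdots X_l$. The limits $\mu(x_{1:m})=\lim_{N\to\infty}\frac1N\sum_{i=1}^NP(X_{i:i+m-1}=x_{1:m})$ exist for all finite strings and define a stationary probability measure $\mu$ on $\{1,\dots,k_0\}^{\mathbb N}$ (the stationary mean), with coordinate maps $\xi_i$. $\mathcal I$ is the shift-invariant $\sigma$-algebra, $F=\mu(\cdot|\mathcal I)$ a regular conditional probability, $H_F(m)=\mathbb E_F[-\log F(\xi_{1:m})]$ (a ratio with $H_F(m)=0$ is interpreted as $+\infty$). *)

theory Defs
  imports "HOL-Probability.Probability"
begin

definition lex_less :: "nat \<times> nat \<Rightarrow> nat \<times> nat \<Rightarrow> bool" where
  "lex_less p q \<longleftrightarrow> fst p < fst q \<or> (fst p = fst q \<and> snd p < snd q)"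

definition lex_enum :: "(nat \<times> nat) set \<Rightarrow> nat \<Rightarrow> nat \<times> nat" where
  "lex_enum S j = (THE p. p \<in> S \<and> card {q \<in> S. lex_less q p} = j - 1)"

text \<open>Distribution of the level-n randomness: the random k_n-subset of
  {1..k_(n-1)}^2 (uniform) together with C_n (uniform on {1..k_n}), independent.
  Level 0 carries no subset (empty set) and C_0 uniform on {1..k_0}.\<close>
definition rha_level :: "(nat \<Rightarrow> nat) \<Rightarrow> nat \<Rightarrow> ((nat \<times> nat) set \<times> nat) pmf" where
  "rha_level k n =
     (if n = 0 then pair_pmf (return_pmf {}) (pmf_of_set {1..k 0})
      else pair_pmf
        (pmf_of_set {S. S \<subseteq> {1..k (n - 1)} \<times> {1..k (n - 1)} \<and> card S = k n})
        (pmf_of_set {1..k n}))"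

definition rha_space :: "(nat \<Rightarrow> nat) \<Rightarrow> (nat \<Rightarrow> (nat \<times> nat) set \<times> nat) measure" where
  "rha_space k = (\<Pi>\<^sub>M n\<in>UNIV. measure_pmf (rha_level k n))"

fun rhaY :: "(nat \<Rightarrow> (nat \<times> nat) set \<times> nat) \<Rightarrow> nat \<Rightarrow> nat \<Rightarrow> nat list" where
  "rhaY \<omega> 0 j = [j]"
| "rhaY \<omega> (Suc n) j =
     rhaY \<omega> n (fst (lex_enum (fst (\<omega> (Suc n))) j)) @
     rhaY \<omega> n (snd (lex_enum (fst (\<omega> (Suc n))) j))"

text \<open>The block X_(i:i+m-1) (1-based position i) of the process
  X = Y^0_(C_0) Y^1_(C_1) Y^2_(C_2) ...; since every Y^n_j is nonempty, the first
  i+m levels suffice.\<close>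
definition rha_block :: "(nat \<Rightarrow> (nat \<times> nat) set \<times> nat) \<Rightarrow> nat \<Rightarrow> nat \<Rightarrow> nat list" where
  "rha_block \<omega> i m =
     take m (drop (i - 1) (concat (map (\<lambda>n. rhaY \<omega> n (snd (\<omega> n))) [0..<i + m])))"

definition rha_prob :: "(nat \<Rightarrow> nat) \<Rightarrow> nat \<Rightarrow> nat list \<Rightarrow> real" where
  "rha_prob k i x =
     measure (rha_space k) {\<omega> \<in> space (rha_space k). rha_block \<omega> i (length x) = x}"

text \<open>Sequence space {1..k_0}^N; the coordinate xi_(i+1) is snth _ i, so
  xi_(1:m) = stake m.\<close>
definition seq_space :: "nat \<Rightarrow> nat stream measure" where
  "seq_space k0 = stream_space (count_space {1..k0})"

definition cylinder :: "nat stream measure \<Rightarrow> nat list \<Rightarrow> nat stream set" where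
  "cylinder M x = {\<omega> \<in> space M. stake (length x) \<omega> = x}"

definition is_stationary_mean :: "(nat \<Rightarrow> nat) \<Rightarrow> nat stream measure \<Rightarrow> bool" where
  "is_stationary_mean k \<mu> \<longleftrightarrow>
     prob_space \<mu> \<and> sets \<mu> = sets (seq_space (k 0)) \<and>
     (\<forall>x. (\<lambda>N. (\<Sum>i = 1..N. rha_prob k i x) / real N) \<longlonglongrightarrow> measure \<mu> (cylinder \<mu> x))"

definition invariant_sets :: "nat stream measure \<Rightarrow> nat stream measure" where
  "invariant_sets \<mu> =
     sigma (space \<mu>) {A \<in> sets \<mu>. stl -` A \<inter> space \<mu> = A}"

definition is_reg_cond_prob ::
    "nat stream measure \<Rightarrow> nat stream measure \<Rightarrow> (nat stream \<Rightarrow> nat stream measure) \<Rightarrow> bool" where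
  "is_reg_cond_prob \<mu> I F \<longleftrightarrow>
     (\<forall>\<omega> \<in> space \<mu>. prob_space (F \<omega>) \<and> sets (F \<omega>) = sets \<mu>) \<and>
     (\<forall>A \<in> sets \<mu>.
        (\<lambda>\<omega>. measure (F \<omega>) A) \<in> borel_measurable I \<and>
        (\<forall>B \<in> sets I. (\<integral>\<omega>. indicator B \<omega> * measure (F \<omega>) A \<partial>\<mu>) = measure \<mu> (A \<inter> B)))"

definition block_entropy :: "nat stream measure \<Rightarrow> nat \<Rightarrow> real" where
  "block_entropy G m =
     (\<integral>\<xi>. - log 2 (measure G (cylinder G (stake m \<xi>))) \<partial>G)"

definition exp_code_length ::
    "nat stream measure \<Rightarrow> (nat \<Rightarrow> nat list \<Rightarrow> bool list) \<Rightarrow> nat \<Rightarrow> real" where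
  "exp_code_length G C m = (\<integral>\<xi>. real (length (C m (stake m \<xi>))) \<partial>G)"

definition ratio_inf :: "real \<Rightarrow> real \<Rightarrow> ennreal" where
  "ratio_inf a h = (if h = 0 then \<infinity> else ennreal (a / h))"

definition uniquely_decodable :: "bool list set \<Rightarrow> bool" where
  "uniquely_decodable W \<longleftrightarrow>
     (\<forall>us vs. set us \<subseteq> W \<longrightarrow> set vs \<subseteq> W \<longrightarrow> concat us = concat vs \<longrightarrow> us = vs)"

definition blocks :: "nat \<Rightarrow> nat \<Rightarrow> nat list set" where
  "blocks k0 m = {x. length x = m \<and> set x \<subseteq> {1..k0}}"

definition ud_block_code :: "nat \<Rightarrow> (nat \<Rightarrow> nat list \<Rightarrow> bool list) \<Rightarrow> bool" where
  "ud_block_code k0 C \<longleftrightarrow>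
     (\<forall>m. inj_on (C m) (blocks k0 m) \<and> uniquely_decodable (C m ` blocks k0 m))"

end

theory Submission
  imports Defs "HOL-Real_Asymp.Real_Asymp"
begin

text \<open>
  The universal code pays for the pools of strings, the ergodic measures do not. For a window length
  \<open>m\<close> between \<open>2 ^ (n + 1)\<close> and \<open>2 ^ (n + 2)\<close>, once the pools are fixed the process is eventually a
  concatenation of the \<open>k (n + 2)\<close> strings of level \<open>n + 2\<close>, so almost every component has at most
  \<open>2 ^ (n + 2) * k (n + 2) ^ 2\<close> distinct windows and its block entropy is \<open>O(m powr \<beta>)\<close>. That the
  conditional measure sees these windows only follows from stationarity: the set of sequences all of
  whose windows lie in \<open>T\<close> has the same measure as the invariant set of sequences whose windows
  eventually lie in \<open>T\<close>.

  Unconditionally, a window contains a complete level-\<open>n\<close> string with uniformly distributed index.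
  Unfolding it down to level \<open>j\<close> gives a tuple of \<open>s = 2 ^ (n - j)\<close> indices which, up to probability
  \<open>2 * s ^ 2 / k j\<close>, dominates the uniform distribution on tuples of distinct indices, and distinct
  tuples give distinct strings. Hence no injective code can be shorter than \<open>n * s\<close> with high
  probability as soon as \<open>k j\<close> exceeds a constant multiple of \<open>4 ^ n\<close>, that is, for \<open>2 ^ j\<close> of order
  \<open>n powr (1 / \<beta>)\<close>.
\<close>

section \<open>Enumerations and lists of distinct elements\<close>

text \<open>The rate comes from the choice of \<open>j\<close>. A small \<open>j\<close> makes the
  tuple of \<open>2 ^ (n - j)\<close> indices long, but repetitions among the indices are rare only
  while \<open>k j\<close> exceeds the square of its length (a birthday bound). Since each index is
  worth at least \<open>n\<close> bits, the code spends order n 2^(n - j) bits on a window. Dividing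
  by the entropy bound, of order 2^(\<beta> n), and inserting 2^j of order n^(1/\<beta>) gives n^(1
  - 1/\<beta>) 2^((1 - \<beta>) n), the claimed rate for m of order 2^n. The expectation of the
  ratio causes no difficulty, because the entropy bound is the same number for almost every
  component: the random denominator is replaced by a constant, and the mean of the conditional code
  lengths is the code length under \<mu>. The obstacle is that \<mu> is known only through limits of
  cylinder probabilities, so the pools do not exist on its space and cannot be conditioned on. What
  survives the limit is a property of finite prefixes, namely having few distinct windows. The set
  \<open>T\<close> is then read off from the sequence itself.\<close>

lemma bij_betw_lex_enum:
  assumes "finite S"
  shows "bij_betw (lex_enum S) {1..card S} S"
proof -
  \<comment> \<open>The rank counts the smaller elements and is strictly increasing in the
    lexicographic order. \<open>lex_enum\<close> inverts the rank shifted by one, because positions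
    start at 1.\<close>
  define r where "r p = card {q \<in> S. lex_less q p}" for p
  have less: "r p < r q" if "p \<in> S" "lex_less p q" for p q
    unfolding r_def
    by (rule psubset_card_mono) (use assms that in \<open>auto simp: lex_less_def\<close>)
  have inj: "inj_on r S"
  proof (rule inj_onI)
    fix p q assume pq: "p \<in> S" "q \<in> S" "r p = r q"
    have "lex_less p q \<or> lex_less q p \<or> p = q"
      by (auto simp: lex_less_def prod_eq_iff)
    with less pq show "p = q" by fastforce
  qed
  have "r ` S \<subseteq> {..<card S}"
  proof
    fix x assume "x \<in> r ` S"
    then obtain p where p: "p \<in> S" "x = r p" by auto
    have "r p < card S"
      unfolding r_def by (rule psubset_card_mono) (use assms p in \<open>auto simp: lex_less_def\<close>)
    with p show "x \<in> {..<card S}" by simp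
  qed
  then have img: "r ` S = {..<card S}"
    by (intro card_subset_eq) (auto simp: card_image inj)
  have "bij_betw (\<lambda>p. Suc (r p)) S {1..card S}"
    unfolding bij_betw_def
  proof
    show "inj_on (\<lambda>p. Suc (r p)) S" using inj by (auto simp: inj_on_def)
    have "(\<lambda>p. Suc (r p)) ` S = Suc ` (r ` S)" by auto
    also have "\<dots> = {1..card S}" unfolding img by (auto simp: image_Suc_lessThan)
    finally show "(\<lambda>p. Suc (r p)) ` S = {1..card S}" .
  qed
  note bij = this
  have enum: "lex_enum S (Suc (r p)) = p" if "p \<in> S" for p
    unfolding lex_enum_def
    by (rule the_equality) (use that inj in \<open>auto simp: r_def[symmetric] inj_on_def\<close>)
  have cong: "the_inv_into S (\<lambda>p. Suc (r p)) x = lex_enum S x" if "x \<in> {1..card S}" for x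
  proof -
    have "x \<in> (\<lambda>p. Suc (r p)) ` S"
      unfolding bij_betw_imp_surj_on[OF bij] by (rule that)
    then obtain p where p: "p \<in> S" "x = Suc (r p)" by (rule imageE)
    show ?thesis
      unfolding p(2) enum[OF p(1)] by (rule the_inv_into_f_f[OF bij_betw_imp_inj_on[OF bij] p(1)])
  qed
  have "bij_betw (the_inv_into S (\<lambda>p. Suc (r p))) {1..card S} S = bij_betw (lex_enum S) {1..card S} S"
    by (rule bij_betw_cong) (rule cong)
  with bij_betw_the_inv_into[OF bij] show ?thesis by (rule iffD1[rotated])
qed

text \<open>Repetitions are excluded because a random subset treats all tuples of distinct elements
  of the same length alike, whereas a repeated index merely repeats a string.\<close>

definition dlists :: "'a set \<Rightarrow> nat \<Rightarrow> 'a list set" where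
  "dlists A s = {xs. length xs = s \<and> distinct xs \<and> set xs \<subseteq> A}"

lemma finite_dlists: "finite A \<Longrightarrow> finite (dlists A s)"
  unfolding dlists_def
  by (rule finite_subset[OF _ finite_lists_length_eq[of A s]]) auto

lemma card_dlists_le: "finite A \<Longrightarrow> card (dlists A s) \<le> card A ^ s"
  unfolding dlists_def
  by (subst card_lists_length_eq[symmetric], assumption, rule card_mono)
    (auto intro: finite_lists_length_eq)

text \<open>Every factor of the falling factorial is at least \<open>K - s\<close>, and Bernoulli's
  inequality bounds \<open>(1 - s / K) ^ s\<close> from below by
  \<open>1 - s ^ 2 / K\<close>.\<close>

lemma card_dlists_ge:
  assumes "finite A" "s \<le> card A" "0 < card A"
  shows "real (card (dlists A s)) \<ge> (1 - real s ^ 2 / card A) * real (card A) ^ s"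
proof -
  define K where "K = card A"
  have K: "s \<le> K" "0 < K" using assms by (auto simp: K_def)
  have "(\<Prod>i\<in>{K - s + 1..K}. K - s) \<le> (\<Prod>i\<in>{K - s + 1..K}. i)"
    by (rule prod_mono) auto
  then have "(K - s) ^ s \<le> card (dlists A s)"
    using K assms by (simp add: dlists_def card_lists_distinct_length_eq K_def)
  then have "real (card (dlists A s)) \<ge> (real K - s) ^ s"
    using K by (metis of_nat_diff of_nat_le_iff of_nat_power)
  moreover have "(real K - s) ^ s = (1 + (- (real s / K))) ^ s * real K ^ s"
    using K by (simp add: power_mult_distrib[symmetric] field_simps)
  moreover have "(1 + (- (real s / K))) ^ s \<ge> 1 + real s * (- (real s / K))"
    by (rule Bernoulli_inequality) (use K in \<open>simp add: field_simps\<close>)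
  ultimately have "real (card (dlists A s)) \<ge> (1 + real s * (- (real s / K))) * real K ^ s"
    by (smt (verit) mult_right_mono zero_le_power of_nat_0_le_iff)
  then show ?thesis by (simp add: K_def power2_eq_square)
qed

lemma bij_betw_map_dlists:
  assumes "bij_betw f A B"
  shows "bij_betw (map f) (dlists A s) (dlists B s)"
proof -
  have inj: "inj_on f A" and img: "f ` A = B" using assms by (auto simp: bij_betw_def)
  show ?thesis
    unfolding bij_betw_def
  proof
    show "inj_on (map f) (dlists A s)"
    proof (rule inj_onI)
      fix xs ys assume *: "xs \<in> dlists A s" "ys \<in> dlists A s" "map f xs = map f ys"
      then have "inj_on f (set xs \<union> set ys)"
        using inj by (auto simp: dlists_def intro: inj_on_subset)
      with *(3) show "xs = ys" by (rule map_inj_on)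
    qed
    show "map f ` dlists A s = dlists B s"
    proof
      show "map f ` dlists A s \<subseteq> dlists B s"
      proof
        fix ys assume "ys \<in> map f ` dlists A s"
        then obtain xs where xs: "length xs = s" "distinct xs" "set xs \<subseteq> A" "ys = map f xs"
          by (auto simp: dlists_def)
        have "inj_on f (set xs)" using inj xs(3) by (rule inj_on_subset)
        moreover have "f ` set xs \<subseteq> B" using xs(3) img by blast
        ultimately show "ys \<in> dlists B s"
          using xs by (simp add: dlists_def distinct_map)
      qed
      show "dlists B s \<subseteq> map f ` dlists A s"
      proof
        fix ys assume "ys \<in> dlists B s"
        then have ys: "length ys = s" "distinct ys" "set ys \<subseteq> B" by (auto simp: dlists_def)
        let ?g = "the_inv_into A f"
        have "f (?g y) = y" if "y \<in> set ys" for y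
          using that ys(3) inj img by (intro f_the_inv_into_f) auto
        then have *: "map f (map ?g ys) = ys" by (simp add: map_idI)
        then have "distinct (map ?g ys)"
          using ys(2) by (metis distinct_map)
        moreover have "?g y \<in> A" if "y \<in> set ys" for y
          using that ys(3) inj img by (intro the_inv_into_into) auto
        ultimately have "map ?g ys \<in> dlists A s" using ys(1) by (auto simp: dlists_def)
        with * show "ys \<in> map f ` dlists A s" by (metis image_eqI)
      qed
    qed
  qed
qed

text \<open>Removing \<open>A\<close> leaves an arbitrary subset of the complement with
  \<open>k - s\<close> elements. Only sizes enter the count, and this is the symmetry that the
  averages over tuples exploit.\<close>

lemma card_supersets:
  assumes "finite U" "A \<subseteq> U" "card A = s"
  shows "card {S. S \<subseteq> U \<and> card S = k \<and> A \<subseteq> S} = (if s \<le> k then (card U - s) choose (k - s) else 0)"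
proof -
  have A: "finite A" using assms finite_subset by blast
  show ?thesis
  proof (cases "s \<le> k")
    case True
    have "bij_betw (\<lambda>S. S \<union> A) {S. S \<subseteq> U - A \<and> card S = k - s} {S. S \<subseteq> U \<and> card S = k \<and> A \<subseteq> S}"
    proof (rule bij_betw_byWitness[where f' = "\<lambda>S. S - A"])
      show "(\<lambda>S. S \<union> A) ` {S. S \<subseteq> U - A \<and> card S = k - s} \<subseteq> {S. S \<subseteq> U \<and> card S = k \<and> A \<subseteq> S}"
      proof safe
        fix S assume "S \<subseteq> U - A" "card S = k - s"
        moreover from this have "finite S" using assms(1) by (meson Diff_subset finite_subset)
        ultimately show "card (S \<union> A) = k"
          using A True assms(3) by (subst card_Un_disjoint) auto
      qed (use assms in auto)
      show "(\<lambda>S. S - A) ` {S. S \<subseteq> U \<and> card S = k \<and> A \<subseteq> S} \<subseteq> {S. S \<subseteq> U - A \<and> card S = k - s}"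
        using assms A by (auto simp: card_Diff_subset)
    qed auto
    then have "card {S. S \<subseteq> U \<and> card S = k \<and> A \<subseteq> S} = card {S. S \<subseteq> U - A \<and> card S = k - s}"
      by (simp add: bij_betw_same_card)
    also have "\<dots> = card (U - A) choose (k - s)"
      by (rule n_subsets) (use assms in auto)
    finally show ?thesis using True assms A by (simp add: card_Diff_subset)
  next
    case False
    have "s \<le> k" if "S \<subseteq> U" "card S = k" "A \<subseteq> S" for S
      using card_mono[of S A] finite_subset[of S U] that assms by simp
    then have empty: "{S. S \<subseteq> U \<and> card S = k \<and> A \<subseteq> S} = {}"
      using False by blast
    show ?thesis unfolding empty using False by simp
  qed
qed

section \<open>Independence of the levels\<close>

lemma measurable_binary_countable:
  fixes f :: "'a \<Rightarrow> 'b::countable" and g :: "'a \<Rightarrow> 'c::countable"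
  assumes "f \<in> measurable N (count_space UNIV)" "g \<in> measurable N (count_space UNIV)"
  shows "(\<lambda>x. h (f x) (g x)) \<in> measurable N (count_space UNIV)"
proof (rule measurable_compose_countable[where f = "\<lambda>b x. h b (g x)", OF _ assms(1)])
  show "(\<lambda>x. h b (g x)) \<in> measurable N (count_space UNIV)" for b
    by (rule measurable_compose[OF assms(2)]) simp
qed

locale rha =
  fixes k :: "nat \<Rightarrow> nat"
  assumes k_pos: "0 < k n" and k_mono: "k n \<le> k (Suc n)" and k_le: "k (Suc n) \<le> k n ^ 2"
begin

abbreviation M :: "nat \<Rightarrow> ((nat \<times> nat) set \<times> nat) measure" where
  "M n \<equiv> measure_pmf (rha_level k n)"

abbreviation \<Omega> :: "(nat \<Rightarrow> (nat \<times> nat) set \<times> nat) measure" where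
  "\<Omega> \<equiv> rha_space k"

abbreviation pairs :: "nat \<Rightarrow> (nat \<times> nat) set" where
  "pairs n \<equiv> {1..k n} \<times> {1..k n}"

abbreviation subsets :: "nat \<Rightarrow> (nat \<times> nat) set set" where
  "subsets n \<equiv> {S. S \<subseteq> pairs n \<and> card S = k (Suc n)}"

sublocale product_prob_space M UNIV
  by unfold_locales

sublocale R: prob_space \<Omega>
  unfolding rha_space_def by (rule P.prob_space_axioms)

lemma space_rha [simp]: "space \<Omega> = UNIV"
  by (simp add: rha_space_def space_PiM)

lemma finite_subsets: "finite (subsets n)"
  by (rule finite_subset[of _ "Pow (pairs n)"]) auto

lemma subsets_nonempty: "subsets n \<noteq> {}"
proof -
  have "k (Suc n) \<le> card (pairs n)"
    using k_le[of n] by (simp add: power2_eq_square)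
  then obtain S where "S \<subseteq> pairs n" "card S = k (Suc n)"
    by (meson obtain_subset_with_card_n)
  then show ?thesis by blast
qed

lemma rha_level_Suc:
  "rha_level k (Suc n) = pair_pmf (pmf_of_set (subsets n)) (pmf_of_set {1..k (Suc n)})"
  by (simp add: rha_level_def)

lemma set_pmf_rha_level_Suc: "set_pmf (rha_level k (Suc n)) = subsets n \<times> {1..k (Suc n)}"
  unfolding rha_level_Suc set_pair_pmf
  using k_pos[of "Suc n"] finite_subsets[of n] subsets_nonempty[of n]
  by (simp add: set_pmf_of_set del: Collect_empty_eq)

text \<open>The product space contains arbitrary values of the type. This is the event of full
  measure on which each level is an actual selection, so that combinatorial claims can be made for a
  single \<omega>.\<close>

definition valid :: "(nat \<Rightarrow> (nat \<times> nat) set \<times> nat) \<Rightarrow> bool" where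
  "valid \<omega> \<longleftrightarrow> (\<forall>n. snd (\<omega> n) \<in> {1..k n} \<and> fst (\<omega> (Suc n)) \<in> subsets n)"

lemma AE_valid: "AE \<omega> in \<Omega>. valid \<omega>"
proof -
  have *: "AE \<omega> in \<Omega>. \<omega> n \<in> set_pmf (rha_level k n)" for n
    unfolding rha_space_def by (rule AE_component) (auto simp: AE_measure_pmf)
  have "set_pmf (rha_level k 0) \<subseteq> UNIV \<times> {1..k 0}"
    using k_pos[of 0] by (auto simp: rha_level_def set_pmf_of_set)
  then have 0: "AE \<omega> in \<Omega>. snd (\<omega> 0) \<in> {1..k 0}"
    using *[of 0] by (elim AE_mp) (auto intro!: AE_I2)
  have S: "AE \<omega> in \<Omega>. snd (\<omega> (Suc n)) \<in> {1..k (Suc n)} \<and> fst (\<omega> (Suc n)) \<in> subsets n" for n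
    using *[of "Suc n"] unfolding set_pmf_rha_level_Suc
    by (elim AE_mp) (auto intro!: AE_I2)
  have "AE \<omega> in \<Omega>. snd (\<omega> n) \<in> {1..k n} \<and> fst (\<omega> (Suc n)) \<in> subsets n" for n
    by (cases n) (use 0 S S[of n] in \<open>auto elim: AE_mp intro!: AE_I2\<close>)
  then show ?thesis
    unfolding valid_def by (simp add: AE_all_countable)
qed

lemma measurable_level:
  assumes "n \<in> I"
  shows "(\<lambda>\<omega>. g (\<omega> n)) \<in> measurable (PiM I M) (count_space UNIV)"
  by (rule measurable_compose[OF measurable_component_singleton[OF assms]]) simp

lemma measurable_rhaY_PiM:
  assumes "{..n} \<subseteq> I"
  shows "(\<lambda>\<omega>. rhaY \<omega> n c) \<in> measurable (PiM I M) (count_space UNIV)"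
  using assms
proof (induction n arbitrary: c)
  case 0
  then show ?case by simp
next
  case (Suc n)
  have *: "(\<lambda>\<omega>. rhaY \<omega> n (g (\<omega> (Suc n)))) \<in> measurable (PiM I M) (count_space UNIV)" for g
    by (rule measurable_compose_countable[where f = "\<lambda>c \<omega>. rhaY \<omega> n c"])
      (use Suc.prems in \<open>auto intro!: Suc.IH measurable_level\<close>)
  show ?case
    unfolding rhaY.simps
    by (rule measurable_binary_countable[OF * *])
qed

text \<open>A string of level \<open>n\<close> reads only the coordinates up to \<open>n\<close>;
  this allows it to be treated as a function on a subproduct, where independence applies.\<close>

lemma rhaY_restrict:
  assumes "{..n} \<subseteq> I"
  shows "rhaY (restrict \<omega> I) n c = rhaY \<omega> n c"
  using assms
proof (induction n arbitrary: c)
  case (Suc n)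
  have "{..n} \<subseteq> I" "Suc n \<in> I" using Suc.prems by auto
  then show ?case using Suc.IH by simp
qed simp

lemma measurable_map_rhaY_PiM:
  assumes "{..n} \<subseteq> I"
  shows "(\<lambda>\<omega>. map (rhaY \<omega> n) cs) \<in> measurable (PiM I M) (count_space UNIV)"
proof (induction cs)
  case (Cons c cs)
  show ?case
    unfolding list.map by (rule measurable_binary_countable[OF measurable_rhaY_PiM[OF assms] Cons])
qed simp

lemma indep_coordinates: "R.indep_vars M (\<lambda>n \<omega>. \<omega> n) UNIV"
proof -
  have "(\<lambda>\<omega>. \<omega> n) \<in> measurable \<Omega> (M n)" for n
    unfolding rha_space_def by (rule measurable_component_singleton) simp
  moreover have "distr \<Omega> (M n) (\<lambda>\<omega>. \<omega> n) = M n" for n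
    unfolding rha_space_def by (rule PiM_component) simp
  ultimately show ?thesis
    by (subst R.indep_vars_iff_distr_eq_PiM) (auto simp: rha_space_def restrict_def distr_id2)
qed

text \<open>Conditioning on what is drawn at level \<open>Suc j\<close>, which is independent of all
  that the lower levels determine. The first two hypotheses say that \<open>R v\<close> is an event
  of the coordinates up to \<open>j\<close>; finiteness of \<open>V\<close> turns the conditioning
  into a finite sum.\<close>

lemma prob_level_split:
  fixes g :: "(nat \<times> nat) set \<times> nat \<Rightarrow> 'c::countable"
  assumes meas: "\<And>v. Measurable.pred (PiM {..j} M) (R v)"
    and restr: "\<And>v \<omega>. R v (restrict \<omega> {..j}) = R v \<omega>"
    and V: "finite V" "\<And>x. x \<in> set_pmf (rha_level k (Suc j)) \<Longrightarrow> g x \<in> V"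
  shows "measure \<Omega> {\<omega>. R (g (\<omega> (Suc j))) \<omega>}
    = (\<Sum>v\<in>V. measure (M (Suc j)) {x. g x = v} * measure \<Omega> {\<omega>. R v \<omega>})"
proof -
  have ind: "R.indep_var (PiM {Suc j} M) (\<lambda>\<omega>. restrict \<omega> {Suc j}) (PiM {..j} M) (\<lambda>\<omega>. restrict \<omega> {..j})"
    using R.indep_var_restrict[OF indep_coordinates, of "{Suc j}" "{..j}"] by simp
  have meas': "Measurable.pred \<Omega> (R v)" for v
    using measurable_compose[OF measurable_restrict_subset[of "{..j}" UNIV M] meas[of v]]
    by (simp add: restr rha_space_def)
  have g: "{\<omega>. g (\<omega> (Suc j)) = v} \<in> sets \<Omega>" for v
    using measurable_sets[OF measurable_level[of "Suc j" UNIV g], of "{v}"]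
    by (simp add: rha_space_def[symmetric] vimage_def)
  have sets: "{\<omega>. R v \<omega>} \<in> sets \<Omega>" for v
    using meas'[of v] by (simp add: pred_def)
  have both: "{\<omega>. g (\<omega> (Suc j)) = v \<and> R v \<omega>} \<in> sets \<Omega>" for v
    using sets.Int[OF g[of v] sets[of v]] by (simp add: Collect_conj_eq)
  have prob: "measure \<Omega> {\<omega>. g (\<omega> (Suc j)) = v \<and> R v \<omega>}
      = measure (M (Suc j)) {x. g x = v} * measure \<Omega> {\<omega>. R v \<omega>}" for v
  proof -
    let ?A = "{x \<in> space (PiM {Suc j} M). g (x (Suc j)) = v}"
    let ?B = "{x \<in> space (PiM {..j} M). R v x}"
    have A: "?A \<in> sets (PiM {Suc j} M)"
      using measurable_sets[OF measurable_level[of "Suc j" "{Suc j}" g], of "{v}"]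
      by (simp add: vimage_def Int_def conj_commute)
    have B: "?B \<in> sets (PiM {..j} M)"
      using meas[of v] by (simp add: pred_def)
    have "measure \<Omega> {\<omega>. g (\<omega> (Suc j)) = v} = measure (distr \<Omega> (M (Suc j)) (\<lambda>\<omega>. \<omega> (Suc j))) {x. g x = v}"
      by (subst measure_distr) (auto simp: rha_space_def vimage_def space_PiM)
    also have "distr \<Omega> (M (Suc j)) (\<lambda>\<omega>. \<omega> (Suc j)) = M (Suc j)"
      unfolding rha_space_def by (rule PiM_component) simp
    finally have 1: "measure \<Omega> {\<omega>. g (\<omega> (Suc j)) = v} = measure (M (Suc j)) {x. g x = v}" .
    have 2: "(\<lambda>\<omega>. restrict \<omega> {Suc j}) -` ?A = {\<omega>. g (\<omega> (Suc j)) = v}"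
      by (auto simp: space_PiM)
    have 3: "(\<lambda>\<omega>. restrict \<omega> {..j}) -` ?B = {\<omega>. R v \<omega>}"
      by (auto simp: space_PiM restr)
    have 4: "(\<lambda>x. (restrict x {Suc j}, restrict x {..j})) -` (?A \<times> ?B) = {\<omega>. g (\<omega> (Suc j)) = v \<and> R v \<omega>}"
      by (auto simp: space_PiM restr)
    show ?thesis
      using R.indep_varD[OF ind A B] unfolding 2 3 4 1 space_rha Int_UNIV_right .
  qed
  have "measure \<Omega> {\<omega>. R (g (\<omega> (Suc j))) \<omega>} = measure \<Omega> (\<Union>v\<in>V. {\<omega>. g (\<omega> (Suc j)) = v \<and> R v \<omega>})"
  proof (rule R.finite_measure_eq_AE)
    \<comment> \<open>Off the support of the level, \<open>g\<close> may leave \<open>V\<close>, so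
      the two events agree only almost surely.\<close>
    have "AE \<omega> in \<Omega>. \<omega> (Suc j) \<in> set_pmf (rha_level k (Suc j))"
      unfolding rha_space_def by (rule AE_component) (auto simp: AE_measure_pmf)
    then show "AE \<omega> in \<Omega>. (\<omega> \<in> {\<omega>. R (g (\<omega> (Suc j))) \<omega>}) = (\<omega> \<in> (\<Union>v\<in>V. {\<omega>. g (\<omega> (Suc j)) = v \<and> R v \<omega>}))"
      by (elim AE_mp) (auto intro!: AE_I2 V)
    show "(\<Union>v\<in>V. {\<omega>. g (\<omega> (Suc j)) = v \<and> R v \<omega>}) \<in> sets \<Omega>"
      by (rule sets.finite_UN[OF V(1) both])
    show "{\<omega>. R (g (\<omega> (Suc j))) \<omega>} \<in> sets \<Omega>"
      using measurable_compose_countable[OF meas' measurable_level[of "Suc j" UNIV g, folded rha_space_def]]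
      by (simp add: pred_def)
  qed
  also have "\<dots> = (\<Sum>v\<in>V. measure \<Omega> {\<omega>. g (\<omega> (Suc j)) = v \<and> R v \<omega>})"
    using both V(1)
    by (intro R.finite_measure_finite_Union) (auto simp: disjoint_family_on_def)
  finally show ?thesis by (simp add: prob)
qed

end

section \<open>Lists of pairs and lists of even length\<close>

fun unflat :: "'a list \<Rightarrow> ('a \<times> 'a) list" where
  "unflat (a # b # t) = (a, b) # unflat t"
| "unflat _ = []"

definition flat :: "('a \<times> 'a) list \<Rightarrow> 'a list" where
  "flat ps = concat (map (\<lambda>p. [fst p, snd p]) ps)"

lemma flat_unflat: "even (length t) \<Longrightarrow> flat (unflat t) = t"
  by (induction t rule: unflat.induct) (auto simp: flat_def)

lemma length_unflat: "length (unflat t) = length t div 2"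
  by (induction t rule: unflat.induct) auto

lemma set_unflat: "set (unflat t) \<subseteq> set t \<times> set t"
  by (induction t rule: unflat.induct) auto

lemma distinct_unflat: "distinct t \<Longrightarrow> distinct (unflat t)"
proof (induction t rule: unflat.induct)
  case (1 a b t)
  then show ?case using set_unflat[of t] by auto
qed auto

lemma unflat_dlists: "t \<in> dlists A (2 * s) \<Longrightarrow> unflat t \<in> dlists (A \<times> A) s"
  using set_unflat[of t] by (auto simp: dlists_def length_unflat distinct_unflat)

lemma concat_map_flat: "concat (map (\<lambda>p. f (fst p) @ f (snd p)) ps) = concat (map f (flat ps))"
  by (induction ps) (auto simp: flat_def)

lemma dlists_one: "dlists A 1 = (\<lambda>a. [a]) ` A"
  by (auto simp: dlists_def length_Suc_conv)

lemma pair_pmf_of_set: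
  assumes "finite A" "A \<noteq> {}" "finite B" "B \<noteq> {}"
  shows "pair_pmf (pmf_of_set A) (pmf_of_set B) = pmf_of_set (A \<times> B)"
proof (rule pmf_eqI)
  fix x :: "'a \<times> 'b"
  show "pmf (pair_pmf (pmf_of_set A) (pmf_of_set B)) x = pmf (pmf_of_set (A \<times> B)) x"
    using assms by (cases x) (simp add: pmf_pair card_cartesian_product indicator_def)
qed

section \<open>One random selection, averaged over index tuples\<close>

context rha
begin

lemma prob_level_fst:
  "measure (M (Suc j)) {x. h (fst x)} = real (card {S \<in> subsets j. h S}) / card (subsets j)"
proof -
  have "measure (M (Suc j)) {x. h (fst x)} = measure (map_pmf fst (rha_level k (Suc j))) {S. h S}"
    by (simp add: vimage_def)
  also have "map_pmf fst (rha_level k (Suc j)) = pmf_of_set (subsets j)"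
    unfolding rha_level_Suc by (rule map_fst_pair_pmf)
  also have "measure (measure_pmf (pmf_of_set (subsets j))) {S. h S} = real (card (subsets j \<inter> {S. h S})) / card (subsets j)"
    by (rule measure_pmf_of_set) (use finite_subsets subsets_nonempty in auto)
  also have "subsets j \<inter> {S. h S} = {S \<in> subsets j. h S}" by auto
  finally show ?thesis .
qed

text \<open>The level is uniform on a product of two finite sets; counting the points separately
  above each index yields the average over the index.\<close>

lemma prob_level_snd:
  "measure (M (Suc j)) {x. h (fst x) (snd x)}
    = (\<Sum>c\<in>{1..k (Suc j)}. measure (M (Suc j)) {x. h (fst x) c}) / k (Suc j)"
proof -
  let ?A = "subsets j" and ?B = "{1..k (Suc j)}"
  have level: "rha_level k (Suc j) = pmf_of_set (?A \<times> ?B)"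
    unfolding rha_level_Suc
    by (rule pair_pmf_of_set) (use finite_subsets[of j] subsets_nonempty[of j] k_pos[of "Suc j"] in auto)
  have nonempty: "?A \<times> ?B \<noteq> {}" using subsets_nonempty[of j] k_pos[of "Suc j"] by simp
  have finite: "finite (?A \<times> ?B)" using finite_subsets by blast
  have "measure (M (Suc j)) {x. h (fst x) (snd x)}
      = real (card ((?A \<times> ?B) \<inter> {x. h (fst x) (snd x)})) / card (?A \<times> ?B)"
    unfolding level by (rule measure_pmf_of_set[OF nonempty finite])
  also have "(?A \<times> ?B) \<inter> {x. h (fst x) (snd x)} = (\<lambda>(c, S). (S, c)) ` (SIGMA c:?B. {S \<in> ?A. h S c})"
    by (auto simp: image_def)
  also have "card \<dots> = card (SIGMA c:?B. {S \<in> ?A. h S c})"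
    by (rule card_image) (auto simp: inj_on_def)
  also have "\<dots> = (\<Sum>c\<in>?B. card {S \<in> ?A. h S c})"
    by (rule card_SigmaI) (use finite_subsets in auto)
  also have "real (\<Sum>c\<in>?B. card {S \<in> ?A. h S c}) / card (?A \<times> ?B)
      = (\<Sum>c\<in>?B. real (card {S \<in> ?A. h S c}) / card ?A) / k (Suc j)"
    by (simp add: card_cartesian_product sum_divide_distrib field_simps)
  also have "\<dots> = (\<Sum>c\<in>?B. measure (M (Suc j)) {x. h (fst x) c}) / k (Suc j)"
    by (simp only: prob_level_fst[where h = "\<lambda>S. h S _"])
  finally show ?thesis .
qed

abbreviation joined :: "(nat \<Rightarrow> (nat \<times> nat) set \<times> nat) \<Rightarrow> nat \<Rightarrow> nat \<times> nat \<Rightarrow> nat list" where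
  "joined \<omega> j p \<equiv> rhaY \<omega> j (fst p) @ rhaY \<omega> j (snd p)"

lemma measurable_joined_PiM:
  "(\<lambda>\<omega>. map (joined \<omega> j) ps) \<in> measurable (PiM {..j} M) (count_space UNIV)"
proof (induction ps)
  case (Cons p ps)
  have "(\<lambda>\<omega>. joined \<omega> j p) \<in> measurable (PiM {..j} M) (count_space UNIV)"
    by (rule measurable_binary_countable[OF measurable_rhaY_PiM measurable_rhaY_PiM]) auto
  from measurable_binary_countable[OF this Cons] show ?case
    unfolding list.map by this
qed simp

lemma measurable_pred_joined: "Measurable.pred (PiM {..j} M) (\<lambda>\<omega>. Q (map (joined \<omega> j) ps))"
  by (rule measurable_compose[OF measurable_joined_PiM]) simp

lemma joined_restrict: "map (joined (restrict \<omega> {..j}) j) ps = map (joined \<omega> j) ps"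
  by (simp add: rhaY_restrict)

text \<open>Once the subset is drawn, each index is replaced by its pair. The enumeration is
  injective, so distinct indices give distinct pairs and the sum runs over \<open>dlists\<close>
  again.\<close>

lemma prob_map_rhaY_Suc:
  assumes t: "t \<in> dlists {1..k (Suc j)} s"
  shows "measure \<Omega> {\<omega>. Q (map (rhaY \<omega> (Suc j)) t)}
    = (\<Sum>ps\<in>dlists (pairs j) s. measure (M (Suc j)) {x. map (lex_enum (fst x)) t = ps}
         * measure \<Omega> {\<omega>. Q (map (joined \<omega> j) ps)})"
proof -
  have V: "map (lex_enum (fst x)) t \<in> dlists (pairs j) s" if "x \<in> set_pmf (rha_level k (Suc j))" for x
  proof -
    have S: "fst x \<subseteq> pairs j" "card (fst x) = k (Suc j)"
      using that unfolding set_pmf_rha_level_Suc by auto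
    then have "finite (fst x)" by (auto intro: finite_subset)
    then have "bij_betw (lex_enum (fst x)) {1..k (Suc j)} (fst x)"
      using bij_betw_lex_enum S(2) by metis
    then have "map (lex_enum (fst x)) t \<in> dlists (fst x) s"
      using bij_betw_map_dlists t by (metis bij_betwE)
    then show ?thesis using S(1) by (auto simp: dlists_def)
  qed
  have "measure \<Omega> {\<omega>. Q (map (joined \<omega> j) (map (lex_enum (fst (\<omega> (Suc j)))) t))}
      = (\<Sum>ps\<in>dlists (pairs j) s. measure (M (Suc j)) {x. map (lex_enum (fst x)) t = ps}
           * measure \<Omega> {\<omega>. Q (map (joined \<omega> j) ps)})"
    by (rule prob_level_split[where R = "\<lambda>ps \<omega>. Q (map (joined \<omega> j) ps)" and g = "\<lambda>x. map (lex_enum (fst x)) t"])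
      (auto simp only: joined_restrict measurable_pred_joined intro!: finite_dlists V)
  also have "(\<lambda>\<omega>. map (joined \<omega> j) (map (lex_enum (fst (\<omega> (Suc j)))) t)) = (\<lambda>\<omega>. map (rhaY \<omega> (Suc j)) t)"
    by (rule ext) simp
  finally show ?thesis .
qed

text \<open>The index is drawn independently of the subset and of all lower levels, so it can be
  averaged out. This removes the random index from all later estimates.\<close>

lemma prob_last_index:
  "measure \<Omega> {\<omega>. Q (rhaY \<omega> (Suc j) (snd (\<omega> (Suc j))))}
    = (\<Sum>c\<in>{1..k (Suc j)}. measure \<Omega> {\<omega>. Q (rhaY \<omega> (Suc j) c)}) / k (Suc j)"
proof -
  let ?P = "\<lambda>p. measure \<Omega> {\<omega>. Q (joined \<omega> j p)}"
  let ?m = "\<lambda>c p. measure (M (Suc j)) {x. lex_enum (fst x) c = p}"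
  have e: "lex_enum (fst x) c \<in> pairs j" if "x \<in> set_pmf (rha_level k (Suc j))" "c \<in> {1..k (Suc j)}" for x c
  proof -
    have S: "fst x \<subseteq> pairs j" "card (fst x) = k (Suc j)"
      using that unfolding set_pmf_rha_level_Suc by auto
    then have "finite (fst x)" by (auto intro: finite_subset)
    then have "bij_betw (lex_enum (fst x)) {1..k (Suc j)} (fst x)"
      using bij_betw_lex_enum S(2) by metis
    then show ?thesis using that(2) S(1) by (meson bij_betwE subsetD)
  qed
  \<comment> \<open>A single pair is treated as a list of one pair, and \<open>hd\<close> undoes the
    wrapping.\<close>
  have meas: "Measurable.pred (PiM {..j} M) (\<lambda>\<omega>. Q (joined \<omega> j p))" for p
    using measurable_pred_joined[where Q = "\<lambda>ys. Q (hd ys)" and ps = "[p]" and j = j] by simp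
  have restr: "Q (joined (restrict \<omega> {..j}) j p) = Q (joined \<omega> j p)" for \<omega> p
    by (simp add: rhaY_restrict)
  have 1: "measure \<Omega> {\<omega>. Q (joined \<omega> j (lex_enum (fst (\<omega> (Suc j))) c))} = (\<Sum>p\<in>pairs j. ?m c p * ?P p)"
    if "c \<in> {1..k (Suc j)}" for c
    by (rule prob_level_split[where R = "\<lambda>p \<omega>. Q (joined \<omega> j p)" and g = "\<lambda>x. lex_enum (fst x) c", OF meas restr])
      (use e that in auto)
  have "measure \<Omega> {\<omega>. Q (joined \<omega> j (lex_enum (fst (\<omega> (Suc j))) (snd (\<omega> (Suc j)))))}
      = (\<Sum>p\<in>pairs j. measure (M (Suc j)) {x. lex_enum (fst x) (snd x) = p} * ?P p)"
    by (rule prob_level_split[where R = "\<lambda>p \<omega>. Q (joined \<omega> j p)" and g = "\<lambda>x. lex_enum (fst x) (snd x)", OF meas restr])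
      (use e set_pmf_rha_level_Suc in auto)
  also have "\<dots> = (\<Sum>p\<in>pairs j. (\<Sum>c\<in>{1..k (Suc j)}. ?m c p) / k (Suc j) * ?P p)"
    by (simp only: prob_level_snd[where h = "\<lambda>S c. lex_enum S c = _"])
  also have "\<dots> = (\<Sum>p\<in>pairs j. (\<Sum>c\<in>{1..k (Suc j)}. ?m c p * ?P p)) / k (Suc j)"
    by (simp only: sum_divide_distrib sum_distrib_right times_divide_eq_left)
  also have "(\<Sum>p\<in>pairs j. (\<Sum>c\<in>{1..k (Suc j)}. ?m c p * ?P p)) = (\<Sum>c\<in>{1..k (Suc j)}. (\<Sum>p\<in>pairs j. ?m c p * ?P p))"
    by (rule sum.swap)
  also have "\<dots> = (\<Sum>c\<in>{1..k (Suc j)}. measure \<Omega> {\<omega>. Q (rhaY \<omega> (Suc j) c)})"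
    by (rule sum.cong) (simp_all only: 1[symmetric] rhaY.simps)
  finally show ?thesis by simp
qed

text \<open>The random subset contains a given set of pairs with a probability depending only on its size;
  the value of this probability is read off from the case \<open>Q = (\<lambda>_. True)\<close>.\<close>
lemma average_rhaY_Suc:
  assumes s: "s \<le> k (Suc j)"
  shows "(\<Sum>t\<in>dlists {1..k (Suc j)} s. measure \<Omega> {\<omega>. Q (map (rhaY \<omega> (Suc j)) t)}) / card (dlists {1..k (Suc j)} s)
    = (\<Sum>ps\<in>dlists (pairs j) s. measure \<Omega> {\<omega>. Q (map (joined \<omega> j) ps)}) / card (dlists (pairs j) s)"
proof -
  let ?D = "dlists {1..k (Suc j)} s"
  define \<rho> where "\<rho> = real (if s \<le> k (Suc j) then (card (pairs j) - s) choose (k (Suc j) - s) else 0) / card (subsets j)"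
  have rho: "(\<Sum>t\<in>?D. measure (M (Suc j)) {x. map (lex_enum (fst x)) t = ps}) = \<rho>"
    if ps: "ps \<in> dlists (pairs j) s" for ps
  proof -
    have "(\<Sum>t\<in>?D. real (card {S \<in> subsets j. map (lex_enum S) t = ps}))
        = (\<Sum>t\<in>?D. \<Sum>S\<in>subsets j. of_bool (map (lex_enum S) t = ps))"
      by (rule sum.cong[OF refl]) (use finite_subsets[of j] in \<open>simp add: sum_of_bool_eq Int_def\<close>)
    also have "\<dots> = (\<Sum>S\<in>subsets j. \<Sum>t\<in>?D. of_bool (map (lex_enum S) t = ps))"
      by (rule sum.swap)
    \<comment> \<open>For a fixed subset the enumeration is a bijection from distinct index tuples
      to distinct tuples of its elements. Hence exactly one \<open>t\<close> is mapped to
      \<open>ps\<close> if the subset contains \<open>ps\<close>, and none otherwise.\<close>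
    also have "\<dots> = (\<Sum>S\<in>subsets j. of_bool (set ps \<subseteq> S))"
    proof (rule sum.cong[OF refl])
      fix S assume S: "S \<in> subsets j"
      then have fin: "finite S" by (auto intro: finite_subset)
      then have "bij_betw (lex_enum S) {1..k (Suc j)} S"
        using bij_betw_lex_enum S by force
      then have bij: "bij_betw (map (lex_enum S)) ?D (dlists S s)"
        by (rule bij_betw_map_dlists)
      have "(\<Sum>t\<in>?D. of_bool (map (lex_enum S) t = ps)) = (\<Sum>qs\<in>dlists S s. of_bool (qs = ps) :: real)"
        by (rule sum.reindex_bij_betw[OF bij])
      also have "\<dots> = of_bool (ps \<in> dlists S s)"
        using finite_dlists[OF fin] by (simp add: of_bool_def)
      also have "(ps \<in> dlists S s) = (set ps \<subseteq> S)"
        using ps by (auto simp: dlists_def)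
      finally show "(\<Sum>t\<in>?D. of_bool (map (lex_enum S) t = ps)) = (of_bool (set ps \<subseteq> S) :: real)" .
    qed
    also have "\<dots> = card {S \<in> subsets j. set ps \<subseteq> S}"
      using finite_subsets[of j] by (simp add: sum_of_bool_eq Int_def)
    also have "{S \<in> subsets j. set ps \<subseteq> S} = {S. S \<subseteq> pairs j \<and> card S = k (Suc j) \<and> set ps \<subseteq> S}"
      by auto
    also have "card \<dots> = (if s \<le> k (Suc j) then (card (pairs j) - s) choose (k (Suc j) - s) else 0)"
      by (rule card_supersets) (use ps in \<open>auto simp: dlists_def distinct_card\<close>)
    finally show ?thesis
      by (simp add: prob_level_fst[where h = "\<lambda>S. map (lex_enum S) _ = _"] \<rho>_def sum_divide_distrib[symmetric])
  qed
  have main: "(\<Sum>t\<in>?D. measure \<Omega> {\<omega>. Q (map (rhaY \<omega> (Suc j)) t)})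
      = \<rho> * (\<Sum>ps\<in>dlists (pairs j) s. measure \<Omega> {\<omega>. Q (map (joined \<omega> j) ps)})" for Q
  proof -
    have "(\<Sum>t\<in>?D. measure \<Omega> {\<omega>. Q (map (rhaY \<omega> (Suc j)) t)})
        = (\<Sum>t\<in>?D. \<Sum>ps\<in>dlists (pairs j) s. measure (M (Suc j)) {x. map (lex_enum (fst x)) t = ps}
            * measure \<Omega> {\<omega>. Q (map (joined \<omega> j) ps)})"
      by (rule sum.cong[OF refl]) (rule prob_map_rhaY_Suc)
    also have "\<dots> = (\<Sum>ps\<in>dlists (pairs j) s. \<Sum>t\<in>?D. measure (M (Suc j)) {x. map (lex_enum (fst x)) t = ps}
            * measure \<Omega> {\<omega>. Q (map (joined \<omega> j) ps)})"
      by (rule sum.swap)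
    also have "\<dots> = (\<Sum>ps\<in>dlists (pairs j) s. \<rho> * measure \<Omega> {\<omega>. Q (map (joined \<omega> j) ps)})"
      by (rule sum.cong[OF refl]) (simp only: sum_distrib_right[symmetric] rho)
    finally show ?thesis by (simp add: sum_distrib_left)
  qed
  have card: "real (card ?D) = \<rho> * card (dlists (pairs j) s)"
    using main[of "\<lambda>_. True"] R.prob_space by simp
  have "0 < card ?D"
  proof -
    have "[1..<Suc s] \<in> ?D" using s by (auto simp: dlists_def)
    then show ?thesis using finite_dlists[of "{1..k (Suc j)}" s] card_gt_0_iff by blast
  qed
  with card have "\<rho> \<noteq> 0" by auto
  then show ?thesis unfolding main card by simp
qed

section \<open>Tuples of distinct indices\<close>

lemma k_le_k_add: "k j \<le> k (j + d)"
  by (induction d) (auto intro: order_trans[OF _ k_mono])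

lemma length_rhaY [simp]: "length (rhaY \<omega> n c) = 2 ^ n"
  by (induction n arbitrary: c) auto

lemma measurable_rhaY: "(\<lambda>\<omega>. rhaY \<omega> n c) \<in> measurable \<Omega> (count_space UNIV)"
  unfolding rha_space_def by (rule measurable_rhaY_PiM) simp

lemma measurable_map_rhaY: "(\<lambda>\<omega>. map (rhaY \<omega> n) cs) \<in> measurable \<Omega> (count_space UNIV)"
  unfolding rha_space_def by (rule measurable_map_rhaY_PiM) simp

lemma measurable_last_rhaY: "(\<lambda>\<omega>. rhaY \<omega> n (snd (\<omega> n))) \<in> measurable \<Omega> (count_space UNIV)"
  using measurable_compose_countable[OF measurable_rhaY measurable_level[of n UNIV snd, folded rha_space_def]]
  by simp

lemma sets_Collect_count:
  assumes "f \<in> measurable \<Omega> (count_space UNIV)"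
  shows "{\<omega>. Q (f \<omega>)} \<in> sets \<Omega>"
  using measurable_sets[OF assms, of "{x. Q x}"] by (simp add: vimage_def)

text \<open>The probability of \<open>Q\<close> for the strings selected by an independent uniform
  tuple of distinct indices. The tuple is averaged over explicitly instead of being added to the
  probability space.\<close>

definition avg :: "nat \<Rightarrow> nat \<Rightarrow> (nat list \<Rightarrow> bool) \<Rightarrow> real" where
  "avg j s Q = (\<Sum>t\<in>dlists {1..k j} s. measure \<Omega> {\<omega>. Q (concat (map (rhaY \<omega> j) t))}) / card (dlists {1..k j} s)"

lemma avg_nonneg: "0 \<le> avg j s Q"
  unfolding avg_def by (intro divide_nonneg_nonneg sum_nonneg) auto

lemma card_dlists_pos: "finite A \<Longrightarrow> s \<le> card A \<Longrightarrow> 0 < card (dlists A s)"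
proof -
  assume A: "finite A" "s \<le> card A"
  then obtain B where "B \<subseteq> A" "card B = s" by (meson obtain_subset_with_card_n)
  moreover from this A(1) obtain xs where "set xs = B" "distinct xs"
    using finite_distinct_list finite_subset by metis
  ultimately have "xs \<in> dlists A s" by (auto simp: dlists_def distinct_card)
  then show ?thesis using finite_dlists[OF A(1)] by (auto simp: card_gt_0_iff)
qed

text \<open>The loss comes from tuples of distinct pairs whose components are not all distinct.\<close>
lemma avg_Suc_ge:
  assumes s: "2 * s \<le> k j"
  shows "avg (Suc j) s Q \<ge> (1 - (2 * real s) ^ 2 / k j) * avg j (2 * s) Q"
proof -
  let ?D = "dlists {1..k j} (2 * s)"
  let ?P = "\<lambda>t. measure \<Omega> {\<omega>. Q (concat (map (rhaY \<omega> j) t))}"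
  have fin: "finite (pairs j)" by simp
  have "k j \<le> k j * k j" using k_pos[of j] by simp
  then have "s \<le> k j * k j" using s by linarith
  then have sle: "s \<le> card (pairs j)" "s \<le> k (Suc j)"
    using s k_mono[of j] by auto
  have P: "?P (flat ps) = measure \<Omega> {\<omega>. Q (concat (map (joined \<omega> j) ps))}" for ps
    by (simp add: concat_map_flat)
  have inj: "inj_on unflat ?D"
    by (rule inj_on_inverseI[where g = flat]) (auto simp: dlists_def flat_unflat)
  have "(\<Sum>t\<in>?D. ?P t) = (\<Sum>ps\<in>unflat ` ?D. ?P (flat ps))"
    by (subst sum.reindex[OF inj]) (auto intro!: sum.cong simp: flat_unflat dlists_def)
  also have "\<dots> \<le> (\<Sum>ps\<in>dlists (pairs j) s. ?P (flat ps))"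
    by (rule sum_mono2) (auto intro: finite_dlists dest: unflat_dlists)
  finally have sum: "(\<Sum>t\<in>?D. ?P t) \<le> (\<Sum>ps\<in>dlists (pairs j) s. ?P (flat ps))" .
  \<comment> \<open>\<open>K\<close> is the number of all tuples of \<open>s\<close> pairs,
    repetitions included. It separates the two counts: tuples of distinct pairs are at most
    \<open>K\<close>, tuples of distinct indices are at least \<open>K\<close> times the factor to
    be shown.\<close>
  define K where "K = real (k j) ^ (2 * s)"
  have K: "0 < K" using k_pos[of j] by (simp add: K_def)
  have D: "0 < real (card ?D)" using card_dlists_pos[of "{1..k j}" "2 * s"] s by simp
  have E: "0 < real (card (dlists (pairs j) s))" using card_dlists_pos[OF fin sle(1)] by simp
  have EK: "real (card (dlists (pairs j) s)) \<le> K"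
  proof -
    have "card (dlists (pairs j) s) \<le> card (pairs j) ^ s" by (rule card_dlists_le) simp
    also have "card (pairs j) ^ s = k j ^ (2 * s)"
      by (simp add: power_mult power2_eq_square)
    finally show ?thesis unfolding K_def by (metis of_nat_le_iff of_nat_power)
  qed
  have DK: "(1 - (2 * real s) ^ 2 / k j) * K \<le> card ?D"
    using card_dlists_ge[of "{1..k j}" "2 * s"] s k_pos[of j] by (simp add: K_def)
  have S0: "0 \<le> (\<Sum>t\<in>?D. ?P t)" by (intro sum_nonneg) auto
  have "(1 - (2 * real s) ^ 2 / k j) * avg j (2 * s) Q \<le> (card ?D / K) * avg j (2 * s) Q"
    by (rule mult_right_mono) (use DK K avg_nonneg in \<open>auto simp: field_simps\<close>)
  also have "\<dots> = (\<Sum>t\<in>?D. ?P t) / K"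
    using D by (simp add: avg_def)
  also have "\<dots> \<le> (\<Sum>t\<in>?D. ?P t) / card (dlists (pairs j) s)"
    by (rule divide_left_mono) (use S0 EK E K in auto)
  also have "\<dots> \<le> (\<Sum>ps\<in>dlists (pairs j) s. ?P (flat ps)) / card (dlists (pairs j) s)"
    by (rule divide_right_mono[OF sum]) simp
  also have "\<dots> = avg (Suc j) s Q"
    using average_rhaY_Suc[OF sle(2), of "\<lambda>ys. Q (concat ys)"] by (simp only: avg_def P)
  finally show ?thesis .
qed

text \<open>One level down costs the square of the new tuple length divided by the number of
  strings, which is at least \<open>k j\<close>. The costs add up to 4 + ... + 4^d times
  \<open>s ^ 2 / k j\<close>, where the series has the sum 4/3 of \<open>4 ^ d - 1\<close>. The
  factor 2 rounds this up so that the induction closes.\<close>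

lemma avg_add_ge:
  assumes "2 ^ d * s \<le> k j"
  shows "avg (j + d) s Q \<ge> (1 - 2 * (4 ^ d - 1) * real s ^ 2 / k j) * avg j (2 ^ d * s) Q"
  using assms
proof (induction d arbitrary: s)
  case 0
  then show ?case by simp
next
  case (Suc d)
  let ?X = "avg j (2 ^ Suc d * s) Q"
  have "2 * s \<le> 2 ^ Suc d * s" by simp
  also note Suc.prems
  also note k_le_k_add[of j d]
  finally have s: "2 * s \<le> k (j + d)" .
  define a b where "a = (2 * real s) ^ 2 / k j" and "b = 2 * (4 ^ d - 1) * real (2 * s) ^ 2 / k j"
  have kj: "0 < real (k j)" using k_pos[of j] by simp
  have a: "0 \<le> a" using kj by (simp add: a_def)
  have b: "0 \<le> b" unfolding b_def using kj
    by (intro divide_nonneg_nonneg mult_nonneg_nonneg) auto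
  have X: "0 \<le> ?X" by (rule avg_nonneg)
  have "a \<ge> (2 * real s) ^ 2 / k (j + d)"
    unfolding a_def by (rule divide_left_mono) (use kj k_pos[of "j + d"] k_le_k_add[of j d] in auto)
  then have "(1 - a) * avg (j + d) (2 * s) Q \<le> (1 - (2 * real s) ^ 2 / k (j + d)) * avg (j + d) (2 * s) Q"
    by (intro mult_right_mono avg_nonneg) auto
  also have "\<dots> \<le> avg (j + Suc d) s Q"
    using avg_Suc_ge[OF s] by simp
  finally have 1: "(1 - a) * avg (j + d) (2 * s) Q \<le> avg (j + Suc d) s Q" .
  have 2: "(1 - b) * ?X \<le> avg (j + d) (2 * s) Q"
    using Suc.IH[of "2 * s"] Suc.prems by (simp add: b_def mult.assoc mult.left_commute)
  have "a + b \<le> 2 * (4 ^ Suc d - 1) * real s ^ 2 / k j"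
  proof -
    have "a + b = (4 * real s ^ 2 + 2 * (4 ^ d - 1) * (4 * real s ^ 2)) / k j"
      by (simp add: a_def b_def add_divide_distrib power2_eq_square)
    also have "\<dots> \<le> 2 * (4 ^ Suc d - 1) * real s ^ 2 / k j"
      by (rule divide_right_mono) (use kj in \<open>auto simp: algebra_simps\<close>)
    finally show ?thesis .
  qed
  then have "(1 - 2 * (4 ^ Suc d - 1) * real s ^ 2 / k j) * ?X \<le> (1 - a - b) * ?X"
    by (intro mult_right_mono X) auto
  also have "\<dots> \<le> avg (j + Suc d) s Q"
  \<comment> \<open>For \<open>a > 1\<close> the factor \<open>1 - a\<close> is negative and the two
    inequalities cannot be multiplied, but then the left side is at most zero.\<close>
  proof (cases "a \<le> 1")
    case True
    have "1 - a - b \<le> (1 - a) * (1 - b)" using a b by (simp add: algebra_simps)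
    then have "(1 - a - b) * ?X \<le> (1 - a) * ((1 - b) * ?X)"
      using X by (metis mult.assoc mult_right_mono)
    also have "\<dots> \<le> (1 - a) * avg (j + d) (2 * s) Q"
      by (rule mult_left_mono[OF 2]) (use True in simp)
    finally show ?thesis using 1 by simp
  next
    case False
    then have "(1 - a - b) * ?X \<le> 0" using b X by (intro mult_nonpos_nonneg) auto
    then show ?thesis using avg_nonneg[of "j + Suc d" s Q] by simp
  qed
  finally show ?case .
qed

section \<open>Distinct tuples give distinct strings\<close>

lemma lex_enum_valid:
  assumes "valid \<omega>"
  shows "bij_betw (lex_enum (fst (\<omega> (Suc n)))) {1..k (Suc n)} (fst (\<omega> (Suc n)))"
    and "fst (\<omega> (Suc n)) \<subseteq> pairs n"
proof -
  have S: "fst (\<omega> (Suc n)) \<subseteq> pairs n" "card (fst (\<omega> (Suc n))) = k (Suc n)"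
    using assms unfolding valid_def by auto
  then have "finite (fst (\<omega> (Suc n)))" by (auto intro: finite_subset)
  then show "bij_betw (lex_enum (fst (\<omega> (Suc n)))) {1..k (Suc n)} (fst (\<omega> (Suc n)))"
    using bij_betw_lex_enum S(2) by metis
  show "fst (\<omega> (Suc n)) \<subseteq> pairs n" by (rule S(1))
qed

lemma lex_enum_in_pairs:
  assumes "valid \<omega>" "c \<in> {1..k (Suc n)}"
  shows "lex_enum (fst (\<omega> (Suc n))) c \<in> pairs n"
  using lex_enum_valid[OF assms(1), of n] assms(2) by (meson bij_betwE subsetD)

text \<open>Equal strings have equal halves because all halves have the same length. By induction
  the index pairs agree, and the enumeration of pairs is injective.\<close>

lemma inj_on_rhaY:
  assumes "valid \<omega>"
  shows "inj_on (rhaY \<omega> n) {1..k n}"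
proof (induction n)
  case 0
  then show ?case by (auto simp: inj_on_def)
next
  case (Suc n)
  show ?case
  proof (rule inj_onI)
    fix c d assume cd: "c \<in> {1..k (Suc n)}" "d \<in> {1..k (Suc n)}"
      and eq: "rhaY \<omega> (Suc n) c = rhaY \<omega> (Suc n) d"
    let ?e = "lex_enum (fst (\<omega> (Suc n)))"
    have pc: "fst (?e c) \<in> {1..k n}" "snd (?e c) \<in> {1..k n}"
      using lex_enum_in_pairs[OF assms cd(1)] by (auto simp: mem_Times_iff)
    have pd: "fst (?e d) \<in> {1..k n}" "snd (?e d) \<in> {1..k n}"
      using lex_enum_in_pairs[OF assms cd(2)] by (auto simp: mem_Times_iff)
    have "rhaY \<omega> n (fst (?e c)) = rhaY \<omega> n (fst (?e d))" "rhaY \<omega> n (snd (?e c)) = rhaY \<omega> n (snd (?e d))"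
      using eq by (simp_all add: append_eq_append_conv)
    then have "fst (?e c) = fst (?e d)" "snd (?e c) = snd (?e d)"
      using inj_onD[OF Suc.IH] pc pd by blast+
    then have "?e c = ?e d" by (rule prod_eqI)
    then show "c = d"
      by (rule inj_onD[OF bij_betw_imp_inj_on[OF lex_enum_valid(1)[OF assms]] _ cd])
  qed
qed

lemma concat_eq_same_length:
  assumes "\<forall>x\<in>set xs. length x = l" "\<forall>y\<in>set ys. length y = l" "length xs = length ys" "concat xs = concat ys"
  shows "xs = ys"
  by (rule concat_injective[OF assms(4,3)]) (use assms(1,2) in \<open>fastforce dest: set_zip_leftD set_zip_rightD\<close>)

lemma inj_on_concat_rhaY:
  assumes "valid \<omega>"
  shows "inj_on (\<lambda>t. concat (map (rhaY \<omega> j) t)) (dlists {1..k j} s)"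
proof (rule inj_onI)
  fix t u assume t: "t \<in> dlists {1..k j} s" and u: "u \<in> dlists {1..k j} s"
    and eq: "concat (map (rhaY \<omega> j) t) = concat (map (rhaY \<omega> j) u)"
  have "map (rhaY \<omega> j) t = map (rhaY \<omega> j) u"
    by (rule concat_eq_same_length[OF _ _ _ eq, of "2 ^ j"]) (use t u in \<open>auto simp: dlists_def\<close>)
  then show "t = u"
    by (rule map_inj_on)
      (use inj_on_rhaY[OF assms, of j] t u in \<open>auto simp: dlists_def intro: inj_on_subset\<close>)
qed

text \<open>A first moment argument. Whatever the pools are, distinct tuples give distinct strings,
  so at most \<open>card B\<close> tuples hit \<open>B\<close>. Taking the expectation bounds the
  sum of the hitting probabilities by the same number.\<close>

lemma avg_notin_ge:
  assumes B: "finite B" and s: "s \<le> k j"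
  shows "avg j s (\<lambda>y. y \<notin> B) \<ge> 1 - card B / card (dlists {1..k j} s)"
proof -
  let ?D = "dlists {1..k j} s"
  define A where "A t = {\<omega>. concat (map (rhaY \<omega> j) t) \<in> B}" for t
  have A: "A t \<in> sets \<Omega>" for t
    unfolding A_def by (rule sets_Collect_count[OF measurable_map_rhaY, of "\<lambda>ys. concat ys \<in> B"])
  have fin: "finite ?D" by (simp add: finite_dlists)
  have "(\<Sum>t\<in>?D. measure \<Omega> (A t)) = (\<Sum>t\<in>?D. \<integral>\<omega>. indicator (A t) \<omega> \<partial>\<Omega>)"
    by simp
  also have "\<dots> = (\<integral>\<omega>. (\<Sum>t\<in>?D. indicator (A t) \<omega>) \<partial>\<Omega>)"
    using A by (intro Bochner_Integration.integral_sum[symmetric]) (auto simp: R.emeasure_eq_measure)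
  also have "\<dots> \<le> (\<integral>\<omega>. real (card B) \<partial>\<Omega>)"
  proof (rule integral_mono_AE)
    show "integrable \<Omega> (\<lambda>\<omega>. (\<Sum>t\<in>?D. indicator (A t) \<omega>) :: real)"
      using A by (intro Bochner_Integration.integrable_sum) (auto simp: R.emeasure_eq_measure)
    show "AE \<omega> in \<Omega>. (\<Sum>t\<in>?D. indicator (A t) \<omega>) \<le> real (card B)"
      using AE_valid
    proof (rule AE_mp, intro AE_I2 impI)
      fix \<omega> assume v: "valid \<omega>"
      have "(\<Sum>t\<in>?D. indicator (A t) \<omega>) = real (card {t \<in> ?D. concat (map (rhaY \<omega> j) t) \<in> B})"
        using fin by (simp add: A_def indicator_def sum.If_cases Int_def)
      also have "\<dots> \<le> real (card B)"
        unfolding of_nat_le_iff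
        by (rule card_inj_on_le[OF inj_on_subset[OF inj_on_concat_rhaY[OF v, of j s]] _ B]) auto
      finally show "(\<Sum>t\<in>?D. indicator (A t) \<omega>) \<le> real (card B)" .
    qed
  qed simp
  also have "\<dots> = card B" using R.prob_space by simp
  finally have *: "(\<Sum>t\<in>?D. measure \<Omega> (A t)) \<le> card B" .
  have "measure \<Omega> {\<omega>. concat (map (rhaY \<omega> j) t) \<notin> B} = 1 - measure \<Omega> (A t)" for t
    using R.prob_compl[OF A[of t]] by (simp add: A_def Compl_eq_Diff_UNIV[symmetric] Collect_neg_eq)
  then have "(\<Sum>t\<in>?D. measure \<Omega> {\<omega>. concat (map (rhaY \<omega> j) t) \<notin> B}) = card ?D - (\<Sum>t\<in>?D. measure \<Omega> (A t))"
    by (simp add: sum_subtractf)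
  moreover have "0 < real (card ?D)" using card_dlists_pos[of "{1..k j}" s] s by simp
  ultimately have "avg j s (\<lambda>y. y \<notin> B) = 1 - (\<Sum>t\<in>?D. measure \<Omega> (A t)) / card ?D"
    by (simp add: avg_def diff_divide_distrib)
  with divide_right_mono[OF *, of "real (card ?D)"] show ?thesis by simp
qed

end

section \<open>Blocks of the process\<close>

lemma sum_dlists_one: "(\<Sum>t\<in>dlists A 1. f t) = (\<Sum>a\<in>A. f [a])"
  unfolding dlists_one by (rule sum.reindex_cong[of "\<lambda>a. [a]"]) (auto simp: inj_on_def)

lemma card_dlists_one: "card (dlists A 1) = card A"
  unfolding dlists_one by (rule card_image) (auto simp: inj_on_def)

context rha
begin

lemma average_one_rhaY_Suc:
  "(\<Sum>c\<in>{1..k (Suc j)}. measure \<Omega> {\<omega>. Q (rhaY \<omega> (Suc j) c)}) / k (Suc j)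
    = (\<Sum>p\<in>pairs j. measure \<Omega> {\<omega>. Q (joined \<omega> j p)}) / (real (k j) * k j)"
proof -
  have "1 \<le> k (Suc j)" using k_pos[of "Suc j"] by simp
  from average_rhaY_Suc[OF this, where Q = "\<lambda>ys. Q (hd ys)"]
  show ?thesis
    unfolding sum_dlists_one card_dlists_one list.map list.sel card_cartesian_product card_atLeastAtMost by simp
qed

text \<open>On average over the index, a string one level up is the concatenation of two strings
  whose indices form a uniform pair. The constituent lies entirely in one half, so the other index
  averages out and the induction continues in that half.\<close>

lemma average_constituent:
  assumes "b < 2 ^ d"
  shows "(\<Sum>c\<in>{1..k (n + d)}. measure \<Omega> {\<omega>. Q (take (2 ^ n) (drop (b * 2 ^ n) (rhaY \<omega> (n + d) c)))}) / k (n + d)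
    = (\<Sum>a\<in>{1..k n}. measure \<Omega> {\<omega>. Q (rhaY \<omega> n a)}) / k n"
  using assms
proof (induction d arbitrary: b)
  case 0
  then show ?case by simp
next
  case (Suc d)
  let ?j = "n + d"
  let ?blk = "\<lambda>b y. take (2 ^ n) (drop (b * 2 ^ n) y)"
  have kj: "real (k ?j) \<noteq> 0" using k_pos[of ?j] by simp
  have len: "length (rhaY \<omega> ?j c) = 2 ^ d * 2 ^ n" for \<omega> c by (simp add: power_add)
  have eq: "(\<Sum>c\<in>{1..k (Suc ?j)}. measure \<Omega> {\<omega>. Q (?blk b (rhaY \<omega> (Suc ?j) c))}) / k (Suc ?j)
      = (\<Sum>p\<in>pairs ?j. measure \<Omega> {\<omega>. Q (?blk b (joined \<omega> ?j p))}) / (real (k ?j) * k ?j)"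
    by (rule average_one_rhaY_Suc[where Q = "\<lambda>y. Q (?blk b y)"])
  show ?case
  proof (cases "b < 2 ^ d")
    case True
    have "b * 2 ^ n + 2 ^ n = (b + 1) * 2 ^ n" by simp
    also have "\<dots> \<le> 2 ^ d * 2 ^ n" by (rule mult_le_mono1) (use True in simp)
    finally have "2 ^ n \<le> 2 ^ d * 2 ^ n - b * 2 ^ n" by linarith
    then have "?blk b (joined \<omega> ?j p) = ?blk b (rhaY \<omega> ?j (fst p))" for \<omega> p
      by (simp add: len del: length_rhaY)
    then have "(\<Sum>p\<in>pairs ?j. measure \<Omega> {\<omega>. Q (?blk b (joined \<omega> ?j p))})
        = (\<Sum>(a, a')\<in>pairs ?j. measure \<Omega> {\<omega>. Q (?blk b (rhaY \<omega> ?j a))})"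
      by (intro sum.cong) auto
    also have "\<dots> = (\<Sum>a\<in>{1..k ?j}. measure \<Omega> {\<omega>. Q (?blk b (rhaY \<omega> ?j a))}) * k ?j"
      by (simp add: sum.cartesian_product[symmetric] sum_distrib_left mult.commute)
    finally show ?thesis using eq Suc.IH[OF True] kj by simp
  next
    case False
    define b' where "b' = b - 2 ^ d"
    have b': "b' < 2 ^ d" "b = 2 ^ d + b'" using False Suc.prems by (auto simp: b'_def)
    have "?blk b (joined \<omega> ?j p) = ?blk b' (rhaY \<omega> ?j (snd p))" for \<omega> p
      by (simp add: len b'(2) add_mult_distrib del: length_rhaY)
    then have "(\<Sum>p\<in>pairs ?j. measure \<Omega> {\<omega>. Q (?blk b (joined \<omega> ?j p))})
        = (\<Sum>(a, a')\<in>pairs ?j. measure \<Omega> {\<omega>. Q (?blk b' (rhaY \<omega> ?j a'))})"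
      by (intro sum.cong) auto
    also have "\<dots> = (\<Sum>a\<in>{1..k ?j}. measure \<Omega> {\<omega>. Q (?blk b' (rhaY \<omega> ?j a))}) * k ?j"
      by (simp add: sum.cartesian_product[symmetric] mult.commute)
    finally show ?thesis using eq Suc.IH[OF b'(1)] kj by simp
  qed
qed

text \<open>The constituent has a uniform index, which is a tuple of length one at level
  \<open>n\<close>. Unfolding it down to level \<open>j\<close> costs the first error term, and the
  tuples that hit \<open>B\<close> cost the second.\<close>

lemma prob_constituent_ge:
  assumes n: "n < r" and b: "b < 2 ^ (r - n)" and j: "j \<le> n" and s: "2 ^ (n - j) \<le> k j"
    and B: "finite B"
  shows "measure \<Omega> {\<omega>. take (2 ^ n) (drop (b * 2 ^ n) (rhaY \<omega> r (snd (\<omega> r)))) \<notin> B}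
    \<ge> 1 - 2 * 4 ^ (n - j) / k j - card B / card (dlists {1..k j} (2 ^ (n - j)))"
proof -
  obtain r' where r': "r = Suc r'" using n by (cases r) auto
  let ?blk = "\<lambda>y. take (2 ^ n) (drop (b * 2 ^ n) y)"
  let ?\<epsilon> = "2 * (4 ^ (n - j) - 1) / real (k j)"
  let ?\<delta> = "card B / card (dlists {1..k j} (2 ^ (n - j)))"
  have kj: "0 < real (k j)" using k_pos[of j] by simp
  have "measure \<Omega> {\<omega>. ?blk (rhaY \<omega> r (snd (\<omega> r))) \<notin> B}
      = (\<Sum>c\<in>{1..k r}. measure \<Omega> {\<omega>. ?blk (rhaY \<omega> r c) \<notin> B}) / k r"
    unfolding r' by (rule prob_last_index[where Q = "\<lambda>y. ?blk y \<notin> B"])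
  also have "\<dots> = (\<Sum>a\<in>{1..k n}. measure \<Omega> {\<omega>. rhaY \<omega> n a \<notin> B}) / k n"
    using average_constituent[OF b, where n = n and Q = "\<lambda>y. y \<notin> B"] n by simp
  also have "\<dots> = avg n 1 (\<lambda>y. y \<notin> B)"
    unfolding avg_def sum_dlists_one card_dlists_one by simp
  finally have eq: "measure \<Omega> {\<omega>. ?blk (rhaY \<omega> r (snd (\<omega> r))) \<notin> B} = avg n 1 (\<lambda>y. y \<notin> B)" .
  let ?a = "avg j (2 ^ (n - j)) (\<lambda>y. y \<notin> B)"
  have 1: "(1 - ?\<epsilon>) * ?a \<le> avg n 1 (\<lambda>y. y \<notin> B)"
    using avg_add_ge[of "n - j" 1 j "\<lambda>y. y \<notin> B"] s j by simp
  have 2: "1 - ?\<delta> \<le> ?a" by (rule avg_notin_ge[OF B s])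
  have "?a \<le> (\<Sum>t\<in>dlists {1..k j} (2 ^ (n - j)). 1) / card (dlists {1..k j} (2 ^ (n - j)))"
    unfolding avg_def by (rule divide_right_mono[OF sum_mono]) (auto simp: R.prob_le_1)
  also have "\<dots> \<le> 1" by simp
  finally have 3: "?a \<le> 1" .
  have "?\<epsilon> \<le> 2 * 4 ^ (n - j) / k j"
    by (rule divide_right_mono) (use kj in auto)
  moreover have "0 \<le> ?\<epsilon>" using kj by (intro divide_nonneg_nonneg mult_nonneg_nonneg) auto
  then have "?\<epsilon> * ?a \<le> ?\<epsilon>" using 3 by (metis mult_left_le)
  then have "?a - ?\<epsilon> \<le> (1 - ?\<epsilon>) * ?a" by (simp add: algebra_simps)
  ultimately show ?thesis using 1 2 eq by linarith
qed

text \<open>The sum 1 + 2 + ... + 2^(N - 1). As positions start at 1, level \<open>r\<close>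
  occupies exactly the positions from \<open>2 ^ r\<close> to \<open>2 ^ (r + 1) - 1\<close>, and
  all later index arithmetic rests on this.\<close>

lemma length_prefix: "length (concat (map (\<lambda>n. rhaY \<omega> n (snd (\<omega> n))) [0..<N])) = 2 ^ N - 1"
proof (induction N)
  case (Suc N)
  then have "length (concat (map (\<lambda>n. rhaY \<omega> n (snd (\<omega> n))) [0..<Suc N])) = 2 ^ N - 1 + 2 ^ N"
    by (simp del: length_concat)
  also have "\<dots> = 2 ^ Suc N - 1"
    using one_le_power[of "2::nat" N] by simp
  finally show ?case .
qed simp

lemma concat_levels_split:
  assumes "r \<le> N"
  shows "concat (map (\<lambda>n. rhaY \<omega> n (snd (\<omega> n))) [0..<N])
    = concat (map (\<lambda>n. rhaY \<omega> n (snd (\<omega> n))) [0..<r]) @ concat (map (\<lambda>n. rhaY \<omega> n (snd (\<omega> n))) [r..<N])"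
proof -
  have "[0..<N] = [0..<r] @ [r..<N]"
    using assms upt_add_eq_append[of 0 r "N - r"] by simp
  then show ?thesis by simp
qed

lemma rha_block_tail:
  assumes "2 ^ r \<le> i"
  shows "rha_block \<omega> i m = take m (drop (i - 2 ^ r) (concat (map (\<lambda>n. rhaY \<omega> n (snd (\<omega> n))) [r..<i + m])))"
proof -
  have "r < 2 ^ r" by (rule less_exp)
  then have r: "r \<le> i + m" using assms by linarith
  have "i - 1 = (2 ^ r - 1) + (i - 2 ^ r)" using assms one_le_power[of "2::nat" r] by simp
  then have "drop (i - 1) (concat (map (\<lambda>n. rhaY \<omega> n (snd (\<omega> n))) [0..<i + m]))
      = drop (i - 2 ^ r) (drop (2 ^ r - 1) (concat (map (\<lambda>n. rhaY \<omega> n (snd (\<omega> n))) [0..<i + m])))"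
    by (simp add: add.commute)
  also have "drop (2 ^ r - 1) (concat (map (\<lambda>n. rhaY \<omega> n (snd (\<omega> n))) [0..<i + m]))
      = concat (map (\<lambda>n. rhaY \<omega> n (snd (\<omega> n))) [r..<i + m])"
    unfolding concat_levels_split[OF r] by (simp only: drop_append length_prefix) (simp add: length_prefix del: length_concat)
  finally show ?thesis by (simp add: rha_block_def)
qed

lemma rha_block_inside:
  assumes "l + m \<le> 2 ^ r" "0 < m"
  shows "rha_block \<omega> (2 ^ r + l) m = take m (drop l (rhaY \<omega> r (snd (\<omega> r))))"
proof -
  have "r < 2 ^ r + l + m" using less_exp[of r] by linarith
  then have "[r..<2 ^ r + l + m] = r # [Suc r..<2 ^ r + l + m]" by (rule upt_conv_Cons)
  then show ?thesis
    using assms by (simp add: rha_block_tail[of r])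
qed

lemma length_rha_block: "1 \<le> i \<Longrightarrow> length (rha_block \<omega> i m) = m"
proof -
  assume i: "1 \<le> i"
  have "m \<le> 2 ^ (i + m) - i" using less_exp[of "i + m"] by linarith
  then show ?thesis
    using i by (simp add: rha_block_def length_prefix del: length_concat)
qed

text \<open>A window of length at least \<open>2 * 2 ^ n\<close> contains a complete aligned
  constituent, whatever its offset. The constituent is a function \<open>f\<close> of the window,
  and the image of \<open>B\<close> under \<open>f\<close> is no larger than \<open>B\<close>, so
  the bound for constituents carries over.\<close>

lemma prob_block_le:
  assumes n: "n < r" "2 ^ (n + 1) \<le> m" and l: "l + m \<le> 2 ^ r"
    and j: "j \<le> n" and s: "2 ^ (n - j) \<le> k j" and B: "finite B"
  shows "measure \<Omega> {\<omega>. rha_block \<omega> (2 ^ r + l) m \<in> B}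
    \<le> 2 * 4 ^ (n - j) / k j + card B / card (dlists {1..k j} (2 ^ (n - j)))"
proof -
  \<comment> \<open>The quotient \<open>l / 2 ^ n\<close> rounded up: the first aligned constituent
    that starts at or after offset \<open>l\<close>.\<close>
  define b where "b = (l + 2 ^ n - 1) div 2 ^ n"
  have p: "0 < (2::nat) ^ n" by simp
  have b1: "l \<le> b * 2 ^ n"
  proof -
    have "l + 2 ^ n - 1 < (b + 1) * 2 ^ n"
      unfolding b_def by (metis Suc_eq_plus1 dividend_less_div_times mult.commute mult_Suc p add.commute)
    then show ?thesis by simp
  qed
  have "b * 2 ^ n \<le> l + 2 ^ n - 1" unfolding b_def by (rule div_times_less_eq_dividend)
  then have b2: "b * 2 ^ n + 2 ^ n \<le> l + m" using n(2) p by (simp add: field_simps)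
  have "(b + 1) * 2 ^ n \<le> 2 ^ (r - n) * 2 ^ n"
    using b2 l n(1) by (simp add: power_add[symmetric])
  then have "b + 1 \<le> 2 ^ (r - n)" unfolding mult_le_cancel2 using p by blast
  then have b3: "b < 2 ^ (r - n)" by simp
  define f where "f x = take (2 ^ n) (drop (b * 2 ^ n - l) x)" for x :: "nat list"
  let ?blk = "\<lambda>\<omega>. take (2 ^ n) (drop (b * 2 ^ n) (rhaY \<omega> r (snd (\<omega> r))))"
  have m: "0 < m" using n(2) by (metis gr0I not_less_zero power_eq_0_iff le_zero_eq zero_neq_numeral)
  have f: "?blk \<omega> = f (rha_block \<omega> (2 ^ r + l) m)" for \<omega>
    unfolding rha_block_inside[OF l m] f_def
    using b1 b2 by (simp add: drop_take min_def)
  have cardB: "card (f ` B) \<le> card B" by (rule card_image_le[OF B])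
  have ev: "{\<omega>. ?blk \<omega> \<in> f ` B} \<in> sets \<Omega>"
    by (rule sets_Collect_count[OF measurable_last_rhaY, where Q = "\<lambda>y. take (2 ^ n) (drop (b * 2 ^ n) y) \<in> f ` B"])
  have "measure \<Omega> {\<omega>. rha_block \<omega> (2 ^ r + l) m \<in> B} \<le> measure \<Omega> {\<omega>. ?blk \<omega> \<in> f ` B}"
    by (rule R.finite_measure_mono[OF _ ev]) (auto simp: f)
  also have "\<dots> = 1 - measure \<Omega> {\<omega>. ?blk \<omega> \<notin> f ` B}"
    using R.prob_compl[OF ev] by (simp add: Compl_eq_Diff_UNIV[symmetric] Collect_neg_eq)
  also have "\<dots> \<le> 2 * 4 ^ (n - j) / k j + card (f ` B) / card (dlists {1..k j} (2 ^ (n - j)))"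
    using prob_constituent_ge[OF n(1) b3 j s, of "f ` B"] B by simp
  also have "card (f ` B) / card (dlists {1..k j} (2 ^ (n - j))) \<le> card B / card (dlists {1..k j} (2 ^ (n - j)))"
    by (rule divide_right_mono) (use cardB in auto)
  finally show ?thesis by simp
qed

end

section \<open>Windows\<close>

definition windows :: "nat \<Rightarrow> 'a list \<Rightarrow> 'a list set" where
  "windows m x = {take m (drop p x) | p. p + m \<le> length x}"

lemma windows_take_drop:
  assumes "0 < m"
  shows "windows m (take N (drop i x)) \<subseteq> windows m x"
proof
  fix w assume "w \<in> windows m (take N (drop i x))"
  then obtain p where p: "p + m \<le> min (length x - i) N" "w = take m (drop p (take N (drop i x)))"
    by (auto simp: windows_def)
  have "m \<le> N - p" using p(1) by linarith
  then have "w = take m (drop (p + i) x)"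
    using p(2) by (simp add: drop_take)
  moreover have "p + i + m \<le> length x" using p(1) assms by linarith
  ultimately show "w \<in> windows m x" unfolding windows_def by blast
qed

text \<open>A window not longer than the constituents meets at most two consecutive ones.\<close>
lemma windows_concat:
  assumes m: "0 < m" "m \<le> l" and len: "\<And>y. y \<in> A \<Longrightarrow> length y = l"
    and ys: "set ys \<subseteq> A"
  shows "windows m (concat ys) \<subseteq> (\<lambda>(p, y, z). take m (drop p (y @ z))) ` ({..<l} \<times> A \<times> A)"
  using ys
proof (induction ys rule: induct_list012)
  case 1
  then show ?case using m by (auto simp: windows_def)
next
  case (2 y)
  show ?case
  proof
    fix w assume "w \<in> windows m (concat [y])"
    then obtain p where p: "p + m \<le> l" "w = take m (drop p y)"
      using 2 len by (auto simp: windows_def)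
    moreover have "length y = l" using 2 len by simp
    ultimately have "w = take m (drop p (y @ y))" by simp
    then show "w \<in> (\<lambda>(p, y, z). take m (drop p (y @ z))) ` ({..<l} \<times> A \<times> A)"
      using p(1) m 2 by (intro image_eqI[of _ _ "(p, y, y)"]) auto
  qed
next
  case (3 y z ys)
  show ?case
  proof
    fix w assume "w \<in> windows m (concat (y # z # ys))"
    then obtain p where p: "p + m \<le> length (concat (y # z # ys))" "w = take m (drop p (concat (y # z # ys)))"
      by (auto simp: windows_def)
    have l: "length y = l" "length z = l" using 3 len by auto
    show "w \<in> (\<lambda>(p, y, z). take m (drop p (y @ z))) ` ({..<l} \<times> A \<times> A)"
    proof (cases "p < l")
      case True
      then have "w = take m (drop p (y @ z))" using p(2) l m by simp
      then show ?thesis using True 3(3) by (intro image_eqI[of _ _ "(p, y, z)"]) auto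
    next
      case False
      then have "w = take m (drop (p - l) (concat (z # ys)))" using p(2) l by simp
      moreover have "p - l + m \<le> length (concat (z # ys))" using p(1) l False by simp
      ultimately have "w \<in> windows m (concat (z # ys))" unfolding windows_def by blast
      then show ?thesis using 3(2,3) by auto
    qed
  qed
qed

lemma finite_windows: "finite (windows m x)"
proof -
  have "windows m x \<subseteq> (\<lambda>p. take m (drop p x)) ` {..length x}"
    by (auto simp: windows_def)
  then show ?thesis by (rule finite_subset) simp
qed

lemma finite_blocks: "finite (blocks k0 m)"
  using finite_lists_length_eq[of "{1..k0}" m] by (simp add: blocks_def conj_commute)

context rha
begin

lemma rhaY_constituents:
  assumes v: "valid \<omega>" and c: "c \<in> {1..k (n + d)}"
  shows "\<exists>ys. rhaY \<omega> (n + d) c = concat ys \<and> set ys \<subseteq> rhaY \<omega> n ` {1..k n}"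
  using c
proof (induction d arbitrary: c)
  case 0
  then show ?case by (intro exI[of _ "[rhaY \<omega> n c]"]) auto
next
  case (Suc d)
  let ?p = "lex_enum (fst (\<omega> (Suc (n + d)))) c"
  have "?p \<in> pairs (n + d)" using lex_enum_in_pairs[OF v] Suc.prems by simp
  then have p: "fst ?p \<in> {1..k (n + d)}" "snd ?p \<in> {1..k (n + d)}" by (auto simp: mem_Times_iff)
  obtain ys where ys: "rhaY \<omega> (n + d) (fst ?p) = concat ys" "set ys \<subseteq> rhaY \<omega> n ` {1..k n}"
    using Suc.IH[OF p(1)] by blast
  obtain zs where zs: "rhaY \<omega> (n + d) (snd ?p) = concat zs" "set zs \<subseteq> rhaY \<omega> n ` {1..k n}"
    using Suc.IH[OF p(2)] by blast
  show ?case
    by (rule exI[of _ "ys @ zs"]) (use ys zs in simp)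
qed

lemma levels_constituents:
  assumes v: "valid \<omega>"
  shows "\<exists>ys. concat (map (\<lambda>n. rhaY \<omega> n (snd (\<omega> n))) [n..<N]) = concat ys \<and> set ys \<subseteq> rhaY \<omega> n ` {1..k n}"
proof (induction N)
  case 0
  then show ?case by (intro exI[of _ "[]"]) simp
next
  case (Suc N)
  show ?case
  proof (cases "n \<le> N")
    case True
    have "snd (\<omega> N) \<in> {1..k (n + (N - n))}" using v True by (simp add: valid_def)
    from rhaY_constituents[OF v this] True obtain zs
      where zs: "rhaY \<omega> N (snd (\<omega> N)) = concat zs" "set zs \<subseteq> rhaY \<omega> n ` {1..k n}" by auto
    from Suc obtain ys where ys: "concat (map (\<lambda>n. rhaY \<omega> n (snd (\<omega> n))) [n..<N]) = concat ys"
      "set ys \<subseteq> rhaY \<omega> n ` {1..k n}" by blast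
    show ?thesis
      by (rule exI[of _ "ys @ zs"]) (use True ys zs in simp)
  next
    case False
    then show ?thesis by (intro exI[of _ "[]"]) simp
  qed
qed

text \<open>From position \<open>2 ^ n\<close> on, the process is a concatenation of
  level-\<open>n\<close> strings, so a window is given by an offset and two strings of the pool. The
  bound is independent of \<open>N\<close>, and therefore it passes to infinite sequences.\<close>

lemma card_windows_rha_block:
  assumes v: "valid \<omega>" and m: "0 < m" "m \<le> 2 ^ n" and i: "2 ^ n \<le> i"
  shows "card (windows m (rha_block \<omega> i N)) \<le> 2 ^ n * k n ^ 2"
proof -
  let ?A = "rhaY \<omega> n ` {1..k n}"
  let ?f = "\<lambda>(p, y, z). take m (drop p (y @ z))"
  obtain ys where ys: "concat (map (\<lambda>n. rhaY \<omega> n (snd (\<omega> n))) [n..<i + N]) = concat ys" "set ys \<subseteq> ?A"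
    using levels_constituents[OF v] by blast
  have "windows m (rha_block \<omega> i N) \<subseteq> windows m (concat ys)"
    unfolding rha_block_tail[OF i] ys(1) by (rule windows_take_drop[OF m(1)])
  also have "\<dots> \<subseteq> ?f ` ({..<2 ^ n :: nat} \<times> ?A \<times> ?A)"
    by (rule windows_concat[OF m _ ys(2)]) auto
  finally have "card (windows m (rha_block \<omega> i N)) \<le> card (?f ` ({..<2 ^ n :: nat} \<times> ?A \<times> ?A))"
    by (rule card_mono[rotated]) simp
  also have "\<dots> \<le> card ({..<2 ^ n :: nat} \<times> ?A \<times> ?A)" by (rule card_image_le) simp
  also have "\<dots> = 2 ^ n * (card ?A * card ?A)" by (simp add: card_cartesian_product)
  also have "\<dots> \<le> 2 ^ n * k n ^ 2"
    using card_image_le[of "{1..k n}" "rhaY \<omega> n"] by (simp add: power2_eq_square mult_le_mono)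
  finally show ?thesis .
qed

lemma rha_block_in_blocks:
  assumes v: "valid \<omega>" and i: "1 \<le> i"
  shows "rha_block \<omega> i m \<in> blocks (k 0) m"
proof -
  obtain ys where ys: "concat (map (\<lambda>n. rhaY \<omega> n (snd (\<omega> n))) [0..<i + m]) = concat ys" "set ys \<subseteq> rhaY \<omega> 0 ` {1..k 0}"
    using levels_constituents[OF v] by blast
  have "set (concat ys) \<subseteq> {1..k 0}" using ys(2) by auto
  then have "set (rha_block \<omega> i m) \<subseteq> {1..k 0}"
    unfolding rha_block_def ys(1) by (meson order_trans set_drop_subset set_take_subset)
  then show ?thesis using length_rha_block[OF i] by (simp add: blocks_def)
qed

lemma measurable_rha_block: "(\<lambda>\<omega>. rha_block \<omega> i m) \<in> measurable \<Omega> (count_space UNIV)"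
proof -
  have "(\<lambda>\<omega>. concat (map (\<lambda>n. rhaY \<omega> n (snd (\<omega> n))) [0..<N])) \<in> measurable \<Omega> (count_space UNIV)" for N
  proof (induction N)
    case (Suc N)
    from measurable_binary_countable[OF Suc measurable_last_rhaY[of N], of "(@)"] show ?case by simp
  qed simp
  from measurable_compose[OF this, of "\<lambda>y. take m (drop (i - 1) y)"] show ?thesis
    unfolding rha_block_def by simp
qed

text \<open>Both blocks are cut from the same truncation of the process to \<open>Suc i + m\<close>
  levels, so the shift is literal.\<close>

lemma rha_block_Suc:
  assumes "1 \<le> i"
  shows "rha_block \<omega> (Suc i) m = tl (rha_block \<omega> i (Suc m))"
proof -
  define W where "W = concat (map (\<lambda>n. rhaY \<omega> n (snd (\<omega> n))) [0..<Suc i + m])"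
  have "rha_block \<omega> (Suc i) m = take m (drop (Suc (i - 1)) W)"
    using assms by (simp add: rha_block_def W_def)
  moreover have "rha_block \<omega> i (Suc m) = take (Suc m) (drop (i - 1) W)"
    by (simp only: rha_block_def W_def add_Suc add_Suc_right)
  ultimately show ?thesis by (simp add: tl_take drop_Suc tl_drop)
qed

lemma sum_rha_prob:
  assumes X: "finite X" "\<And>x. x \<in> X \<Longrightarrow> length x = m"
  shows "(\<Sum>x\<in>X. rha_prob k i x) = measure \<Omega> {\<omega>. rha_block \<omega> i m \<in> X}"
proof -
  have "(\<Sum>x\<in>X. rha_prob k i x) = (\<Sum>x\<in>X. measure \<Omega> {\<omega>. rha_block \<omega> i m = x})"
    by (rule sum.cong) (simp_all add: rha_prob_def X)
  also have "\<dots> = measure \<Omega> (\<Union>x\<in>X. {\<omega>. rha_block \<omega> i m = x})"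
    by (rule R.finite_measure_finite_Union[symmetric, OF X(1)])
      (auto simp: disjoint_family_on_def intro!: sets_Collect_count[OF measurable_rha_block])
  also have "(\<Union>x\<in>X. {\<omega>. rha_block \<omega> i m = x}) = {\<omega>. rha_block \<omega> i m \<in> X}" by auto
  finally show ?thesis .
qed

end

locale rha_mean = rha +
  fixes \<mu> :: "nat stream measure"
  assumes mean: "is_stationary_mean k \<mu>"
begin

sublocale mu: prob_space \<mu>
  using mean by (simp add: is_stationary_mean_def)

lemma sets_mu: "sets \<mu> = sets (stream_space (count_space {1..k 0}))"
  using mean by (simp add: is_stationary_mean_def seq_space_def)

lemma space_mu: "space \<mu> = streams {1..k 0}"
  using sets_eq_imp_space_eq[OF sets_mu] by (simp add: space_stream_space)

end

lemma stake_in_blocks: "\<xi> \<in> streams {1..k0} \<Longrightarrow> stake m \<xi> \<in> blocks k0 m"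
  unfolding blocks_def using snth_in[of \<xi> "{1..k0}"] by (auto simp: in_set_conv_nth)

lemma sets_stake_in:
  fixes G :: "nat stream measure"
  assumes "sets G = sets (stream_space (count_space {1..k0}))"
  shows "{\<xi> \<in> space G. stake m \<xi> \<in> X} \<in> sets G"
proof -
  have "cylinder G x \<in> sets G" for x
  proof -
    have "cylinder G x = {\<xi> \<in> space G. \<forall>i\<in>{..<length x}. \<xi> !! i = x ! i}"
      unfolding cylinder_def by (auto simp: list_eq_iff_nth_eq)
    also have "{\<xi> \<in> space G. \<xi> !! i = a} \<in> sets G" for i a
    proof -
      have "(\<lambda>\<xi>. \<xi> !! i) \<in> measurable G (count_space {1..k0})"
        unfolding measurable_cong_sets[OF assms refl] by (rule measurable_snth)
      from measurable_sets[OF this, of "{a} \<inter> {1..k0}"]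
      have "(\<lambda>\<xi>. \<xi> !! i) -` ({a} \<inter> {1..k0}) \<inter> space G \<in> sets G" by simp
      also have "(\<lambda>\<xi>. \<xi> !! i) -` ({a} \<inter> {1..k0}) \<inter> space G = {\<xi> \<in> space G. \<xi> !! i = a}"
        using sets_eq_imp_space_eq[OF assms] by (auto simp: space_stream_space dest: snth_in)
      finally show ?thesis .
    qed
    then have "{\<xi> \<in> space G. \<forall>i\<in>{..<length x}. \<xi> !! i = x ! i} \<in> sets G"
      by (intro sets.sets_Collect_finite_All) auto
    finally show ?thesis .
  qed
  note cyl = this
  have "{\<xi> \<in> space G. stake m \<xi> \<in> X} = (\<Union>x\<in>X \<inter> {x. length x = m}. cylinder G x)"
    by (auto simp: cylinder_def)
  also have "\<dots> \<in> sets G" by (rule sets.countable_UN'') (auto intro: cyl)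
  finally show ?thesis .
qed

section \<open>The stationary mean\<close>

context rha_mean
begin

lemma sets_stake_mu: "{\<xi> \<in> space \<mu>. stake m \<xi> \<in> X} \<in> sets \<mu>"
  by (rule sets_stake_in[OF sets_mu])

lemma mean_limit:
  assumes X: "finite X" "\<And>x. x \<in> X \<Longrightarrow> length x = m"
  shows "(\<lambda>N. (\<Sum>i = 1..N. measure \<Omega> {\<omega>. rha_block \<omega> i m \<in> X}) / real N)
    \<longlonglongrightarrow> measure \<mu> {\<xi> \<in> space \<mu>. stake m \<xi> \<in> X}"
proof -
  have "(\<lambda>N. \<Sum>x\<in>X. (\<Sum>i = 1..N. rha_prob k i x) / real N) \<longlonglongrightarrow> (\<Sum>x\<in>X. measure \<mu> (cylinder \<mu> x))"
    by (rule tendsto_sum) (use mean in \<open>simp add: is_stationary_mean_def\<close>)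
  also have "(\<lambda>N. \<Sum>x\<in>X. (\<Sum>i = 1..N. rha_prob k i x) / real N)
      = (\<lambda>N. (\<Sum>i = 1..N. measure \<Omega> {\<omega>. rha_block \<omega> i m \<in> X}) / real N)"
  proof
    fix N
    have "(\<Sum>x\<in>X. \<Sum>i = 1..N. rha_prob k i x) = (\<Sum>i = 1..N. \<Sum>x\<in>X. rha_prob k i x)"
      by (rule sum.swap)
    also have "\<dots> = (\<Sum>i = 1..N. measure \<Omega> {\<omega>. rha_block \<omega> i m \<in> X})"
      by (rule sum.cong[OF refl]) (rule sum_rha_prob[OF X])
    finally show "(\<Sum>x\<in>X. (\<Sum>i = 1..N. rha_prob k i x) / real N)
      = (\<Sum>i = 1..N. measure \<Omega> {\<omega>. rha_block \<omega> i m \<in> X}) / real N"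
      unfolding sum_divide_distrib[symmetric] by simp
  qed
  also have "(\<Sum>x\<in>X. measure \<mu> (cylinder \<mu> x)) = measure \<mu> (\<Union>x\<in>X. cylinder \<mu> x)"
    by (rule mu.finite_measure_finite_Union[symmetric, OF X(1)])
      (use X(2) sets_stake_mu[of "length _" "{_}"] in \<open>auto simp: disjoint_family_on_def cylinder_def\<close>)
  also have "(\<Union>x\<in>X. cylinder \<mu> x) = {\<xi> \<in> space \<mu>. stake m \<xi> \<in> X}"
    using X(2) by (auto simp: cylinder_def)
  finally show ?thesis .
qed

text \<open>For each prefix length, only the finitely many start positions before level
  \<open>n\<close> can produce too many windows, and they vanish in the Cesaro mean. There are
  countably many prefix lengths.\<close>

lemma AE_few_windows:
  assumes m: "0 < m" "m \<le> 2 ^ n"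
  shows "AE \<xi> in \<mu>. \<forall>N. card (windows m (stake N \<xi>)) \<le> 2 ^ n * k n ^ 2"
proof -
  define K where "K = 2 ^ n * k n ^ 2"
  have "AE \<xi> in \<mu>. card (windows m (stake N \<xi>)) \<le> K" for N
  proof -
    define X where "X = {x \<in> blocks (k 0) N. \<not> card (windows m x) \<le> K}"
    have X: "finite X" "\<And>x. x \<in> X \<Longrightarrow> length x = N"
      by (auto simp: X_def intro: finite_subset[OF _ finite_blocks]) (simp add: blocks_def)
    let ?p = "\<lambda>i. measure \<Omega> {\<omega>. rha_block \<omega> i N \<in> X}"
    have zero: "?p i = 0" if "2 ^ n \<le> i" for i
    proof -
      have "AE \<omega> in \<Omega>. \<not> rha_block \<omega> i N \<in> X"
        using AE_valid by (rule AE_mp) (auto intro!: AE_I2 simp: X_def K_def dest: card_windows_rha_block[OF _ m that])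
      then have "?p i = measure \<Omega> {}"
        using sets_Collect_count[OF measurable_rha_block, of "\<lambda>x. x \<in> X" i N]
        by (intro R.finite_measure_eq_AE) auto
      then show ?thesis by simp
    qed
    have bound: "(\<Sum>i = 1..L. ?p i) \<le> 2 ^ n" for L
    proof -
      have "(\<Sum>i = 1..L. ?p i) = (\<Sum>i \<in> {1..L} \<inter> {..<2 ^ n}. ?p i)"
        by (rule sum.mono_neutral_right) (auto intro!: zero)
      also have "\<dots> \<le> (\<Sum>i \<in> {1..L} \<inter> {..<2 ^ n}. 1)" by (rule sum_mono) (simp add: R.prob_le_1)
      also have "\<dots> \<le> real (card {..<2 ^ n :: nat})"
        using card_mono[of "{..<2 ^ n :: nat}" "{1..L} \<inter> {..<2 ^ n}"] by (simp del: card_lessThan)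
      also have "\<dots> = 2 ^ n" by simp
      finally show ?thesis .
    qed
    have "(\<lambda>L. (\<Sum>i = 1..L. ?p i) / real L) \<longlonglongrightarrow> 0"
    proof (rule tendsto_sandwich[OF _ _ tendsto_const lim_const_over_n[of "2 ^ n"]])
      show "\<forall>\<^sub>F L in sequentially. 0 \<le> (\<Sum>i = 1..L. ?p i) / real L"
        by (intro always_eventually allI divide_nonneg_nonneg sum_nonneg) auto
      show "\<forall>\<^sub>F L in sequentially. (\<Sum>i = 1..L. ?p i) / real L \<le> 2 ^ n / real L"
        by (intro always_eventually allI divide_right_mono bound) auto
    qed
    then have "measure \<mu> {\<xi> \<in> space \<mu>. stake N \<xi> \<in> X} = 0"
      using mean_limit[OF X] LIMSEQ_unique by blast
    then have "AE \<xi> in \<mu>. \<not> stake N \<xi> \<in> X"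
      using mu.prob_eq_0[OF sets_stake_mu] by (auto elim: AE_mp intro!: AE_I2)
    then show ?thesis
      by (rule AE_mp) (auto intro!: AE_I2 simp: X_def space_mu stake_in_blocks)
  qed
  then show ?thesis by (simp add: AE_all_countable K_def)
qed

section \<open>Shift invariance of the mean\<close>

lemma measurable_stl_mu: "stl \<in> measurable \<mu> \<mu>"
  unfolding measurable_cong_sets[OF sets_mu sets_mu] by (rule measurable_stl)

text \<open>The block at position \<open>Suc i\<close> is the tail of a longer block at
  \<open>i\<close>. Hence both sides are limits of averages of one sequence, in one case shifted by
  a place, and the averages differ by two boundary terms divided by \<open>N\<close>.\<close>

lemma stationary_cylinder:
  assumes x: "x \<in> blocks (k 0) m"
  shows "measure \<mu> {\<xi> \<in> space \<mu>. stake m (stl \<xi>) = x} = measure \<mu> {\<xi> \<in> space \<mu>. stake m \<xi> = x}"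
proof -
  \<comment> \<open>The extensions of \<open>x\<close> by one letter on the left: a sequence starts
    with a member of \<open>X\<close> iff its shift starts with \<open>x\<close>.\<close>
  define X where "X = (\<lambda>a. a # x) ` {1..k 0}"
  have X: "finite X" "\<And>y. y \<in> X \<Longrightarrow> length y = Suc m"
    using x by (auto simp: X_def blocks_def)
  have x': "finite {x}" "\<And>y. y \<in> {x} \<Longrightarrow> length y = m" using x by (auto simp: blocks_def)
  let ?p = "\<lambda>i. measure \<Omega> {\<omega>. rha_block \<omega> i m \<in> {x}}"
  have shift: "measure \<Omega> {\<omega>. rha_block \<omega> i (Suc m) \<in> X} = ?p (Suc i)" if i: "1 \<le> i" for i
  proof (rule R.finite_measure_eq_AE)
    show "AE \<omega> in \<Omega>. (\<omega> \<in> {\<omega>. rha_block \<omega> i (Suc m) \<in> X}) = (\<omega> \<in> {\<omega>. rha_block \<omega> (Suc i) m \<in> {x}})"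
      using AE_valid
    proof (rule AE_mp, intro AE_I2 impI)
      fix \<omega> assume "valid \<omega>"
      then have "rha_block \<omega> i (Suc m) \<in> blocks (k 0) (Suc m)" using i by (rule rha_block_in_blocks)
      then show "(\<omega> \<in> {\<omega>. rha_block \<omega> i (Suc m) \<in> X}) = (\<omega> \<in> {\<omega>. rha_block \<omega> (Suc i) m \<in> {x}})"
        unfolding mem_Collect_eq rha_block_Suc[OF i]
        by (cases "rha_block \<omega> i (Suc m)") (auto simp: X_def blocks_def)
    qed
  qed (rule sets_Collect_count[OF measurable_rha_block])+
  have "(\<lambda>N. (\<Sum>i = 1..N. ?p (Suc i)) / real N) \<longlonglongrightarrow> measure \<mu> {\<xi> \<in> space \<mu>. stake (Suc m) \<xi> \<in> X}"
    using mean_limit[OF X] by (simp add: shift cong: sum.cong_simp)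
  moreover have "(\<lambda>N. (\<Sum>i = 1..N. ?p (Suc i)) / real N) \<longlonglongrightarrow> measure \<mu> {\<xi> \<in> space \<mu>. stake m \<xi> \<in> {x}}"
  proof -
    have "(\<lambda>N. (\<Sum>i = 1..N. ?p i) / real N + (?p (Suc N) - ?p 1) / real N)
        \<longlonglongrightarrow> measure \<mu> {\<xi> \<in> space \<mu>. stake m \<xi> \<in> {x}} + 0"
    proof (rule tendsto_add[OF mean_limit[OF x']])
      show "(\<lambda>N. (?p (Suc N) - ?p 1) / real N) \<longlonglongrightarrow> 0"
      proof (rule tendsto_rabs_zero_cancel, rule tendsto_sandwich[OF _ _ tendsto_const lim_const_over_n[of 1]])
        have "\<bar>?p (Suc N) - ?p 1\<bar> \<le> 1" for N
          using R.prob_le_1[of "{\<omega>. rha_block \<omega> (Suc N) m \<in> {x}}"] R.prob_le_1[of "{\<omega>. rha_block \<omega> 1 m \<in> {x}}"]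
            measure_nonneg[of \<Omega> "{\<omega>. rha_block \<omega> (Suc N) m \<in> {x}}"] measure_nonneg[of \<Omega> "{\<omega>. rha_block \<omega> 1 m \<in> {x}}"]
          by linarith
        then show "\<forall>\<^sub>F N in sequentially. \<bar>(?p (Suc N) - ?p 1) / real N\<bar> \<le> 1 / real N"
          unfolding abs_divide abs_of_nat by (intro always_eventually allI divide_right_mono) auto
      qed simp
    qed
    moreover have "(\<Sum>i = 1..N. ?p (Suc i)) = (\<Sum>i = 1..N. ?p i) + (?p (Suc N) - ?p 1)" for N
      by (induction N) auto
    ultimately show ?thesis by (simp only: add_divide_distrib add_0_right)
  qed
  ultimately have "measure \<mu> {\<xi> \<in> space \<mu>. stake (Suc m) \<xi> \<in> X} = measure \<mu> {\<xi> \<in> space \<mu>. stake m \<xi> \<in> {x}}"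
    by (rule LIMSEQ_unique)
  moreover have "{\<xi> \<in> space \<mu>. stake (Suc m) \<xi> \<in> X} = {\<xi> \<in> space \<mu>. stake m (stl \<xi>) = x}"
    by (auto simp: X_def space_mu dest: streams_shd)
  ultimately show ?thesis by simp
qed

lemma sstart_eq_stake: "sstart S xs = {\<xi> \<in> streams S. stake (length xs) \<xi> = xs}" if "xs \<in> lists S"
  using sstart_in_streams[OF that] sstart_eq[of _ S xs] by (fastforce simp: list_eq_iff_nth_eq)

lemma stationary: "distr \<mu> \<mu> stl = \<mu>"
proof (rule measure_eqI_generator_eq[OF Int_stable_sstart])
  let ?E = "sstart {1..k 0} ` lists {1..k 0} \<union> {{}}"
  show "?E \<subseteq> Pow (streams {1..k 0})"
    by (auto dest: sstart_in_streams del: in_listsD)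
  show "sets (distr \<mu> \<mu> stl) = sigma_sets (streams {1..k 0}) ?E" "sets \<mu> = sigma_sets (streams {1..k 0}) ?E"
    using \<open>?E \<subseteq> _\<close> by (simp_all add: sets_mu sets_stream_space_sstart)
  show "range (\<lambda>i::nat. streams {1..k 0}) \<subseteq> ?E"
    by (auto intro!: image_eqI[of _ _ "[]"])
  show "(\<Union>i::nat. streams {1..k 0}) = streams {1..k 0}" by simp
  show "emeasure (distr \<mu> \<mu> stl) (streams {1..k 0}) \<noteq> \<infinity>"
    using finite_measure.emeasure_finite[OF prob_space.finite_measure[OF mu.prob_space_distr[OF measurable_stl_mu]]] by simp
  fix A assume "A \<in> ?E"
  then consider "A = {}" | xs where "xs \<in> lists {1..k 0}" "A = sstart {1..k 0} xs" by blast
  then show "emeasure (distr \<mu> \<mu> stl) A = emeasure \<mu> A"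
  proof cases
    case 2
    let ?m = "length xs"
    have A: "A = {\<xi> \<in> space \<mu>. stake ?m \<xi> = xs}"
      unfolding 2(2) space_mu by (rule sstart_eq_stake[OF 2(1)])
    have sets: "A \<in> sets \<mu>" using sets_stake_mu[of ?m "{xs}"] by (simp add: A)
    have eq: "stl -` A \<inter> space \<mu> = {\<xi> \<in> space \<mu>. stake ?m (stl \<xi>) = xs}"
      using measurable_space[OF measurable_stl_mu] by (auto simp: A)
    have xs: "xs \<in> blocks (k 0) ?m" using 2(1) by (auto simp: blocks_def)
    show ?thesis
      unfolding emeasure_distr[OF measurable_stl_mu sets] eq mu.emeasure_eq_measure
        stationary_cylinder[OF xs] A[symmetric] ..
  qed simp
qed

end

section \<open>Entropy of the conditional measures\<close>

lemma integral_stake: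
  fixes f :: "nat list \<Rightarrow> real"
  assumes G: "prob_space G" "sets G = sets (stream_space (count_space {1..k0}))"
  shows "(\<integral>\<xi>. f (stake m \<xi>) \<partial>G) = (\<Sum>x\<in>blocks k0 m. f x * measure G {\<xi> \<in> space G. stake m \<xi> = x})"
proof -
  interpret prob_space G by (rule G(1))
  let ?A = "\<lambda>x. {\<xi> \<in> space G. stake m \<xi> = x}"
  have A: "?A x \<in> sets G" for x using sets_stake_in[OF G(2), of m "{x}"] by simp
  have "stake m \<xi> \<in> blocks k0 m" if "\<xi> \<in> space G" for \<xi>
    using that sets_eq_imp_space_eq[OF G(2)] by (intro stake_in_blocks) (simp add: space_stream_space)
  then have "(\<integral>\<xi>. f (stake m \<xi>) \<partial>G) = (\<integral>\<xi>. (\<Sum>x\<in>blocks k0 m. f x * indicator (?A x) \<xi>) \<partial>G)"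
    by (intro Bochner_Integration.integral_cong)
      (auto simp: indicator_def sum.If_cases finite_blocks if_distrib[of "\<lambda>x. _ * x"] cong: if_cong)
  also have "\<dots> = (\<Sum>x\<in>blocks k0 m. \<integral>\<xi>. f x * indicator (?A x) \<xi> \<partial>G)"
    using A by (intro Bochner_Integration.integral_sum) (auto simp: emeasure_eq_measure)
  also have "\<dots> = (\<Sum>x\<in>blocks k0 m. f x * measure G (?A x))"
    using A by simp
  finally show ?thesis .
qed

lemma sum_prob_stake:
  assumes G: "prob_space G" "sets G = sets (stream_space (count_space {1..k0}))"
  shows "(\<Sum>x\<in>blocks k0 m. measure G {\<xi> \<in> space G. stake m \<xi> = x}) = 1"
  using integral_stake[OF G, of "\<lambda>_. 1" m] prob_space.prob_space[OF G(1)] by simp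

lemma cylinder_blocks: "x \<in> blocks k0 m \<Longrightarrow> cylinder G x = {\<xi> \<in> space G. stake m \<xi> = x}"
  by (simp add: cylinder_def blocks_def)

lemma block_entropy_eq:
  assumes G: "prob_space G" "sets G = sets (stream_space (count_space {1..k0}))"
  shows "block_entropy G m = (\<Sum>x\<in>blocks k0 m.
    - log 2 (measure G {\<xi> \<in> space G. stake m \<xi> = x}) * measure G {\<xi> \<in> space G. stake m \<xi> = x})"
  unfolding block_entropy_def integral_stake[OF G, of "\<lambda>x. - log 2 (measure G (cylinder G x))"]
  by (rule sum.cong) (simp_all add: cylinder_blocks)

lemma block_entropy_nonneg:
  assumes G: "prob_space G" "sets G = sets (stream_space (count_space {1..k0}))"
  shows "0 \<le> block_entropy G m"
proof -
  have "log 2 p \<le> 0" if "0 \<le> p" "p \<le> 1" for p :: real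
    using that by (cases "p = 0") (auto simp: log_def divide_le_0_iff)
  then show ?thesis
    unfolding block_entropy_eq[OF G]
    by (intro sum_nonneg mult_nonneg_nonneg) (auto simp: prob_space.prob_le_1[OF G(1)])
qed

text \<open>Gibbs' inequality against the weight \<open>1 / K\<close> on each point of
  \<open>T\<close>, obtained pointwise from ln x <= x - 1. These weights have total at most 1, so
  the correction terms sum to at most zero.\<close>

lemma block_entropy_le_log_card:
  assumes G: "prob_space G" "sets G = sets (stream_space (count_space {1..k0}))"
    and T: "T \<subseteq> blocks k0 m" "real (card T) \<le> K" "measure G {\<xi> \<in> space G. stake m \<xi> \<in> T} = 1"
    and K: "0 < K"
  shows "block_entropy G m \<le> log 2 K"
proof -
  interpret prob_space G by (rule G(1))
  define p where "p x = measure G {\<xi> \<in> space G. stake m \<xi> = x}" for x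
  have p0: "0 \<le> p x" for x by (simp add: p_def)
  have zero: "p x = 0" if "x \<notin> T" for x
  proof -
    have "{\<xi> \<in> space G. stake m \<xi> = x} \<subseteq> space G - {\<xi> \<in> space G. stake m \<xi> \<in> T}"
      using that by auto
    then have "p x \<le> measure G (space G - {\<xi> \<in> space G. stake m \<xi> \<in> T})"
      unfolding p_def by (intro finite_measure_mono) (auto intro: sets_stake_in[OF G(2)])
    then show ?thesis
      using prob_compl[OF sets_stake_in[OF G(2), of m T]] T(3) p0[of x] by simp
  qed
  have fT: "finite T" using T(1) finite_blocks by (rule finite_subset)
  have sumT: "(\<Sum>x\<in>T. p x) = 1"
    using sum.mono_neutral_right[OF finite_blocks T(1), of p] zero sum_prob_stake[OF G, of m]
    by (simp add: p_def)
  have summand: "- ln (p x) * p x \<le> p x * ln K + (1 / K - p x)" for x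
  proof (cases "p x = 0")
    case True
    then show ?thesis using K by simp
  next
    case False
    then have pos: "0 < p x" using p0[of x] by simp
    have "- ln (p x) = ln K + ln (1 / (K * p x))"
      using pos K by (simp add: ln_div ln_mult)
    also have "\<dots> \<le> ln K + (1 / (K * p x) - 1)"
      using ln_le_minus_one[of "1 / (K * p x)"] pos K by simp
    finally have "- ln (p x) * p x \<le> (ln K + (1 / (K * p x) - 1)) * p x"
      using pos by (intro mult_right_mono) auto
    also have "\<dots> = p x * ln K + (1 / K - p x)" using pos K by (simp add: field_simps)
    finally show ?thesis .
  qed
  have "block_entropy G m = (\<Sum>x\<in>blocks k0 m. - log 2 (p x) * p x)"
    unfolding p_def by (rule block_entropy_eq[OF G])
  also have "\<dots> = (\<Sum>x\<in>T. - log 2 (p x) * p x)"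
    by (rule sum.mono_neutral_right[OF finite_blocks T(1)]) (auto simp: zero)
  also have "\<dots> = (\<Sum>x\<in>T. - ln (p x) * p x) / ln 2"
    by (simp add: log_def sum_divide_distrib sum_negf)
  also have "(\<Sum>x\<in>T. - ln (p x) * p x) \<le> (\<Sum>x\<in>T. p x * ln K + (1 / K - p x))"
    by (rule sum_mono) (rule summand)
  also have "\<dots> = (\<Sum>x\<in>T. p x) * ln K + (card T / K - (\<Sum>x\<in>T. p x))"
    by (simp add: sum.distrib sum_subtractf sum_distrib_right)
  also have "\<dots> \<le> ln K" using sumT T(2) K by simp
  finally show ?thesis by (simp add: log_def divide_right_mono)
qed

section \<open>Sets of sequences defined by their windows\<close>

context rha_mean
begin

definition all_windows_in :: "nat \<Rightarrow> nat list set \<Rightarrow> nat stream set" where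
  "all_windows_in m T = {\<xi> \<in> space \<mu>. \<forall>p. stake m (sdrop p \<xi>) \<in> T}"

text \<open>\<open>all_windows_in\<close> is carried into itself by the shift, but its preimage
  under the shift may be larger. Allowing an arbitrary delay \<open>q\<close> yields a set equal to
  its preimage, as \<open>invariant_sets\<close> demands.\<close>

definition eventual_windows_in :: "nat \<Rightarrow> nat list set \<Rightarrow> nat stream set" where
  "eventual_windows_in m T = {\<xi> \<in> space \<mu>. \<exists>q. sdrop q \<xi> \<in> all_windows_in m T}"

lemma sdrop_space: "\<xi> \<in> space \<mu> \<Longrightarrow> sdrop q \<xi> \<in> space \<mu>"
  unfolding space_mu by (induction q arbitrary: \<xi>) (auto simp: streams_stl)

lemma measurable_sdrop_mu: "sdrop q \<in> measurable \<mu> \<mu>"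
  unfolding measurable_cong_sets[OF sets_mu sets_mu] by (rule measurable_sdrop)

lemma sets_all_windows_in: "all_windows_in m T \<in> sets \<mu>"
proof -
  have "{\<xi> \<in> space \<mu>. stake m (sdrop p \<xi>) \<in> T} \<in> sets \<mu>" for p
  proof -
    have "sdrop p -` {\<xi> \<in> space \<mu>. stake m \<xi> \<in> T} \<inter> space \<mu> \<in> sets \<mu>"
      by (rule measurable_sets[OF measurable_sdrop_mu sets_stake_mu])
    also have "sdrop p -` {\<xi> \<in> space \<mu>. stake m \<xi> \<in> T} \<inter> space \<mu> = {\<xi> \<in> space \<mu>. stake m (sdrop p \<xi>) \<in> T}"
      using sdrop_space by auto
    finally show ?thesis .
  qed
  then show ?thesis unfolding all_windows_in_def by (rule sets.sets_Collect_countable_All)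
qed

lemma all_windows_in_sdrop: "\<xi> \<in> all_windows_in m T \<Longrightarrow> sdrop q \<xi> \<in> all_windows_in m T"
  by (auto simp: all_windows_in_def sdrop_space)

lemma all_windows_in_sdrop_stl:
  "sdrop q \<xi> \<in> all_windows_in m T \<Longrightarrow> sdrop q (stl \<xi>) \<in> all_windows_in m T"
  using all_windows_in_sdrop[of "sdrop q \<xi>" m T 1] by simp

lemma measure_sdrop_vimage:
  assumes A: "A \<in> sets \<mu>"
  shows "measure \<mu> {\<xi> \<in> space \<mu>. sdrop q \<xi> \<in> A} = measure \<mu> A"
proof (induction q)
  case 0
  have "{\<xi> \<in> space \<mu>. \<xi> \<in> A} = A" using sets.sets_into_space[OF A] by auto
  then show ?case by simp
next
  case (Suc q)
  let ?B = "{\<xi> \<in> space \<mu>. sdrop q \<xi> \<in> A}"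
  have B: "?B \<in> sets \<mu>"
    using measurable_sets[OF measurable_sdrop_mu A, of q] by (simp add: vimage_def Int_def conj_commute)
  have "measure \<mu> ?B = measure (distr \<mu> \<mu> stl) ?B" by (simp only: stationary)
  also have "\<dots> = measure \<mu> (stl -` ?B \<inter> space \<mu>)" by (rule measure_distr[OF measurable_stl_mu B])
  also have "stl -` ?B \<inter> space \<mu> = {\<xi> \<in> space \<mu>. sdrop (Suc q) \<xi> \<in> A}"
    using measurable_space[OF measurable_stl_mu] by auto
  finally show ?case using Suc by simp
qed

lemma eventual_windows_in_eq:
  "eventual_windows_in m T = (\<Union>q. {\<xi> \<in> space \<mu>. sdrop q \<xi> \<in> all_windows_in m T})"
  by (auto simp: eventual_windows_in_def)

lemma sets_sdrop_all_windows_in: "{\<xi> \<in> space \<mu>. sdrop q \<xi> \<in> all_windows_in m T} \<in> sets \<mu>"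
  using measurable_sets[OF measurable_sdrop_mu sets_all_windows_in, of q m T]
  by (simp add: vimage_def Int_def conj_commute)

text \<open>The sets with delay \<open>q\<close> increase with \<open>q\<close> and all have the
  same measure by stationarity, so their union has this measure as well.\<close>

lemma measure_eventual_windows_in:
  "measure \<mu> (eventual_windows_in m T) = measure \<mu> (all_windows_in m T)"
proof -
  let ?A = "\<lambda>q. {\<xi> \<in> space \<mu>. sdrop q \<xi> \<in> all_windows_in m T}"
  have "incseq ?A"
    by (rule incseq_SucI) (auto intro: all_windows_in_sdrop_stl)
  then have "(\<lambda>q. measure \<mu> (?A q)) \<longlonglongrightarrow> measure \<mu> (eventual_windows_in m T)"
    unfolding eventual_windows_in_eq
    by (intro mu.finite_Lim_measure_incseq) (auto intro: sets_sdrop_all_windows_in)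
  then show ?thesis
    unfolding measure_sdrop_vimage[OF sets_all_windows_in] by (simp add: LIMSEQ_const_iff)
qed

lemma eventual_windows_in_invariant:
  "eventual_windows_in m T \<in> sets (invariant_sets \<mu>)"
proof -
  have "eventual_windows_in m T \<in> sets \<mu>"
    unfolding eventual_windows_in_eq by (rule sets.countable_UN) (auto intro: sets_sdrop_all_windows_in)
  moreover have "stl -` eventual_windows_in m T \<inter> space \<mu> = eventual_windows_in m T"
  proof (intro equalityI subsetI)
    fix \<xi> assume "\<xi> \<in> stl -` eventual_windows_in m T \<inter> space \<mu>"
    then obtain q where "\<xi> \<in> space \<mu>" "sdrop (Suc q) \<xi> \<in> all_windows_in m T"
      by (auto simp: eventual_windows_in_def)
    then show "\<xi> \<in> eventual_windows_in m T"
      unfolding eventual_windows_in_def by blast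
  next
    fix \<xi> assume "\<xi> \<in> eventual_windows_in m T"
    then obtain q where q: "\<xi> \<in> space \<mu>" "sdrop q \<xi> \<in> all_windows_in m T"
      by (auto simp: eventual_windows_in_def)
    have "stl \<xi> \<in> space \<mu>" using measurable_space[OF measurable_stl_mu q(1)] .
    moreover have "sdrop q (stl \<xi>) \<in> all_windows_in m T" using q(2) by (rule all_windows_in_sdrop_stl)
    ultimately show "\<xi> \<in> stl -` eventual_windows_in m T \<inter> space \<mu>"
      using q(1) by (auto simp: eventual_windows_in_def)
  qed
  ultimately show ?thesis
    unfolding invariant_sets_def
    by (subst sets_measure_of) (auto dest: sets.sets_into_space intro!: sigma_sets.Basic)
qed

text \<open>\<open>T\<close> consists of all windows of \<xi> itself. Being finite, it is realised
  at finitely many positions, and one sufficiently long prefix already shows all of it.\<close>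

lemma few_windows_imp_all_windows_in:
  assumes \<xi>: "\<xi> \<in> space \<mu>" and few: "\<And>N. card (windows m (stake N \<xi>)) \<le> K"
  shows "\<exists>T. T \<subseteq> blocks (k 0) m \<and> card T \<le> K \<and> \<xi> \<in> all_windows_in m T"
proof (intro exI conjI)
  let ?f = "\<lambda>p. stake m (sdrop p \<xi>)"
  let ?T = "range ?f"
  show sub: "?T \<subseteq> blocks (k 0) m"
    using sdrop_space[OF \<xi>] by (auto simp: space_mu intro: stake_in_blocks)
  then have "finite ?T" by (rule finite_subset) (rule finite_blocks)
  then obtain P where P: "finite P" "?T = ?f ` P"
    using finite_subset_image[of ?T ?f UNIV] by blast
  define N where "N = Max (insert 0 P) + m"
  have "?T \<subseteq> windows m (stake N \<xi>)"
  proof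
    fix w assume "w \<in> ?T"
    then obtain p where p: "p \<in> P" "w = ?f p" unfolding P(2) by blast
    have "p \<le> Max (insert 0 P)" using P(1) p(1) by (intro Max_ge) auto
    then have N: "p + m \<le> N" by (simp add: N_def)
    then have "w = take m (drop p (stake N \<xi>))"
      by (simp add: p(2) drop_stake take_stake min_def)
    then show "w \<in> windows m (stake N \<xi>)" using N by (auto simp: windows_def)
  qed
  then have "card ?T \<le> card (windows m (stake N \<xi>))" by (rule card_mono[OF finite_windows])
  then show "card ?T \<le> K" using few[of N] by linarith
  show "\<xi> \<in> all_windows_in m ?T" using \<xi> by (auto simp: all_windows_in_def)
qed

end

section \<open>The conditional measure and its windows\<close>

locale rha_ergodic = rha_mean +
  fixes F :: "nat stream \<Rightarrow> nat stream measure"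
  assumes F: "is_reg_cond_prob \<mu> (invariant_sets \<mu>) F"
begin

lemma prob_space_F: "\<omega> \<in> space \<mu> \<Longrightarrow> prob_space (F \<omega>)"
  and sets_F: "\<omega> \<in> space \<mu> \<Longrightarrow> sets (F \<omega>) = sets (stream_space (count_space {1..k 0}))"
  using F sets_mu by (auto simp: is_reg_cond_prob_def)

lemma sets_invariant: "sets (invariant_sets \<mu>) \<subseteq> sets \<mu>"
  unfolding invariant_sets_def by (subst sets_measure_of) (auto dest: sets.sets_into_space intro!: sets.sigma_sets_subset)

lemma measurable_F: "A \<in> sets \<mu> \<Longrightarrow> (\<lambda>\<omega>. measure (F \<omega>) A) \<in> borel_measurable \<mu>"
proof -
  assume "A \<in> sets \<mu>"
  then have "(\<lambda>\<omega>. measure (F \<omega>) A) \<in> borel_measurable (invariant_sets \<mu>)"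
    using F by (simp add: is_reg_cond_prob_def)
  moreover have "space (invariant_sets \<mu>) = space \<mu>"
    unfolding invariant_sets_def by (rule space_measure_of) (auto dest: sets.sets_into_space)
  ultimately show ?thesis
    using sets_invariant by (auto simp: measurable_def)
qed

lemma integral_F: "A \<in> sets \<mu> \<Longrightarrow> B \<in> sets (invariant_sets \<mu>) \<Longrightarrow>
    (\<integral>\<omega>. indicator B \<omega> * measure (F \<omega>) A \<partial>\<mu>) = measure \<mu> (A \<inter> B)"
  using F by (simp add: is_reg_cond_prob_def)

lemma integrable_F: "A \<in> sets \<mu> \<Longrightarrow> B \<in> sets \<mu> \<Longrightarrow> integrable \<mu> (\<lambda>\<omega>. indicator B \<omega> * measure (F \<omega>) A)"
  by (rule mu.integrable_const_bound[of _ 1])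
    (use measurable_F[of A] prob_space.prob_le_1[OF prob_space_F] in
      \<open>auto intro!: AE_I2 borel_measurable_times simp: indicator_def\<close>)

text \<open>The set \<open>?E\<close> need not be invariant, so it cannot serve as the set
  \<open>B\<close> in the defining equation of \<open>F\<close>. The invariant set \<open>?H\<close>
  around it can: the integral over \<open>?H\<close> of the conditional measure of \<open>?E\<close>
  is the full measure of \<open>?H\<close>, which forces the value 1 almost everywhere on
  \<open>?H\<close>.\<close>

lemma AE_F_all_windows_in:
  "AE \<omega> in \<mu>. \<omega> \<in> all_windows_in m T \<longrightarrow> measure (F \<omega>) (all_windows_in m T) = 1"
proof -
  let ?E = "all_windows_in m T" and ?H = "eventual_windows_in m T"
  have sub: "?E \<subseteq> ?H"
    by (auto simp: eventual_windows_in_def all_windows_in_def intro!: exI[of _ 0])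
  have H: "?H \<in> sets \<mu>" using eventual_windows_in_invariant sets_invariant by blast
  let ?g = "\<lambda>\<omega>. indicator ?H \<omega> - indicator ?H \<omega> * measure (F \<omega>) ?E :: real"
  have int: "integrable \<mu> ?g"
    using H by (intro Bochner_Integration.integrable_diff integrable_F sets_all_windows_in) (auto simp: mu.emeasure_eq_measure)
  have "(\<integral>\<omega>. ?g \<omega> \<partial>\<mu>) = measure \<mu> ?H - measure \<mu> (?E \<inter> ?H)"
    using H by (subst Bochner_Integration.integral_diff)
      (auto intro!: integrable_F sets_all_windows_in integral_F eventual_windows_in_invariant simp: mu.emeasure_eq_measure)
  also have "\<dots> = 0"
    using sub by (simp add: measure_eventual_windows_in Int_absorb2)
  finally have "(\<integral>\<omega>. ?g \<omega> \<partial>\<mu>) = 0" .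
  moreover have "AE \<omega> in \<mu>. 0 \<le> ?g \<omega>"
    using prob_space.prob_le_1[OF prob_space_F] by (auto intro!: AE_I2 simp: indicator_def)
  ultimately have "AE \<omega> in \<mu>. ?g \<omega> = 0"
    using integral_nonneg_eq_0_iff_AE[OF int] by simp
  then show ?thesis
    by (rule AE_mp) (use sub in \<open>auto intro!: AE_I2 simp: indicator_def\<close>)
qed

lemma AE_block_entropy_le:
  assumes m: "0 < m" "m \<le> 2 ^ n"
  shows "AE \<omega> in \<mu>. block_entropy (F \<omega>) m \<le> log 2 (2 ^ n * real (k n) ^ 2)"
proof -
  define K where "K = 2 ^ n * k n ^ 2"
  have K: "0 < real K" using k_pos[of n] by (simp add: K_def)
  \<comment> \<open>The set \<open>T\<close> will depend on \<omega>. There are only finitely many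
    candidates, so one null set serves for all of them.\<close>
  have "AE \<omega> in \<mu>. \<forall>T\<in>Pow (blocks (k 0) m). \<omega> \<in> all_windows_in m T \<longrightarrow> measure (F \<omega>) (all_windows_in m T) = 1"
    by (rule AE_finite_allI) (auto intro: AE_F_all_windows_in finite_blocks)
  with AE_few_windows[OF m] AE_space have "AE \<omega> in \<mu>. block_entropy (F \<omega>) m \<le> log 2 (real K)"
  proof eventually_elim
    case (elim \<omega>)
    from few_windows_imp_all_windows_in[OF elim(2), of m K] elim(1) obtain T
      where T: "T \<subseteq> blocks (k 0) m" "card T \<le> K" "\<omega> \<in> all_windows_in m T"
      by (auto simp: K_def)
    interpret F: prob_space "F \<omega>" by (rule prob_space_F[OF elim(2)])
    have sets: "sets (F \<omega>) = sets \<mu>" using sets_F[OF elim(2)] sets_mu by simp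
    have "all_windows_in m T \<subseteq> {\<xi> \<in> space (F \<omega>). stake m \<xi> \<in> T}"
      using sets_eq_imp_space_eq[OF sets] by (auto simp: all_windows_in_def dest: spec[of _ 0])
    then have "measure (F \<omega>) (all_windows_in m T) \<le> measure (F \<omega>) {\<xi> \<in> space (F \<omega>). stake m \<xi> \<in> T}"
      by (rule F.finite_measure_mono) (rule sets_stake_in[OF sets_F[OF elim(2)]])
    moreover have "measure (F \<omega>) (all_windows_in m T) = 1" using elim(3) T by blast
    ultimately have "measure (F \<omega>) {\<xi> \<in> space (F \<omega>). stake m \<xi> \<in> T} = 1"
      using F.prob_le_1[of "{\<xi> \<in> space (F \<omega>). stake m \<xi> \<in> T}"] by linarith
    with T K show ?case
      by (intro block_entropy_le_log_card[OF prob_space_F[OF elim(2)] sets_F[OF elim(2)] T(1)]) auto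
  qed
  then show ?thesis by (simp add: K_def)
qed

end

section \<open>Code lengths\<close>

lemma finite_card_short_bool_lists:
  "finite {w :: bool list. length w \<le> L}" "card {w :: bool list. length w \<le> L} \<le> 2 ^ Suc L"
proof -
  have "{w :: bool list. length w \<le> L} = {w. set w \<subseteq> UNIV \<and> length w \<le> L}" by simp
  also have "card \<dots> = (\<Sum>i\<le>L. 2 ^ i)"
    using card_lists_length_le[of "UNIV :: bool set" L] by simp
  also have "\<dots> \<le> 2 ^ Suc L"
    by (induction L) auto
  finally show "card {w :: bool list. length w \<le> L} \<le> 2 ^ Suc L" .
  show "finite {w :: bool list. length w \<le> L}"
    using finite_lists_length_le[of "UNIV :: bool set" L] by simp
qed

context rha_mean
begin

text \<open>The averages are taken along the ends of complete levels. About half of the positions up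
  to there lie in level \<open>r\<close> and contribute at most 1/2 each, except for the last few;
  the earlier half is bounded trivially by 1. This gives 3/4 in the limit, and 7/8 leaves room for
  the boundary terms.\<close>

lemma mean_le_of_inside_le:
  assumes B: "finite B" "\<And>x. x \<in> B \<Longrightarrow> length x = m"
    and le: "\<And>r l. n < r \<Longrightarrow> l + m \<le> 2 ^ r \<Longrightarrow> measure \<Omega> {\<omega>. rha_block \<omega> (2 ^ r + l) m \<in> B} \<le> 1 / 2"
  shows "measure \<mu> {\<xi> \<in> space \<mu>. stake m \<xi> \<in> B} \<le> 7 / 8"
proof -
  let ?p = "\<lambda>i. measure \<Omega> {\<omega>. rha_block \<omega> i m \<in> B}"
  let ?N = "\<lambda>r. 2 ^ Suc r - 1 :: nat"
  have "strict_mono ?N"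
  proof (rule strict_monoI_Suc)
    fix r :: nat
    have "(1::nat) \<le> 2 ^ r" by simp
    then show "?N r < ?N (Suc r)" unfolding power_Suc by linarith
  qed
  from LIMSEQ_subseq_LIMSEQ[OF mean_limit[OF B] this]
  have lim: "(\<lambda>r. (\<Sum>i = 1..?N r. ?p i) / real (?N r)) \<longlonglongrightarrow> measure \<mu> {\<xi> \<in> space \<mu>. stake m \<xi> \<in> B}"
    by (simp add: comp_def)
  have "(\<Sum>i = 1..?N r. ?p i) / real (?N r) \<le> 7 / 8" if r: "max n (4 * m + 4) < r" for r
  proof -
    \<comment> \<open>With x = 2^r the final comparison is 3/2 x + m <= 7/8 (2 x - 1), that is 4 m +
      7/2 <= x.\<close>
    have big: "4 * m + 4 \<le> 2 ^ r" using r less_exp[of r] by linarith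
    have p1: "?p i \<le> 1" for i by (rule R.prob_le_1)
    have "{1..?N r} = {1..<2 ^ r} \<union> {2 ^ r..<2 ^ r + 2 ^ r}"
      using one_le_power[of "2::nat" r] by auto
    then have "(\<Sum>i = 1..?N r. ?p i) = (\<Sum>i = 1..<2 ^ r. ?p i) + (\<Sum>i = 2 ^ r..<2 ^ r + 2 ^ r. ?p i)"
      by (simp add: sum.union_disjoint ivl_disj_int)
    also have "(\<Sum>i = 1..<2 ^ r. ?p i) \<le> (\<Sum>i = 1..<2 ^ r :: nat. 1)" by (rule sum_mono) (rule p1)
    also have "\<dots> \<le> (2::real) ^ r" by (simp add: of_nat_diff)
    also have "(\<Sum>i = 2 ^ r..<2 ^ r + 2 ^ r. ?p i) = (\<Sum>l<2 ^ r. ?p (2 ^ r + l))"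
      using sum.shift_bounds_nat_ivl[of ?p 0 "2 ^ r" "2 ^ r"] by (simp add: atLeast0LessThan add.commute)
    also have "\<dots> \<le> (\<Sum>l<2 ^ r. 1 / 2 + of_bool (2 ^ r - m < l))"
    proof (rule sum_mono)
      fix l assume "l \<in> {..<2 ^ r :: nat}"
      show "?p (2 ^ r + l) \<le> 1 / 2 + of_bool (2 ^ r - m < l)"
      proof (cases "2 ^ r - m < l")
        case True
        then have "of_bool (2 ^ r - m < l) = (1::real)" by simp
        then show ?thesis using p1[of "2 ^ r + l"] by linarith
      next
        case False
        then have "l + m \<le> 2 ^ r" using big by linarith
        then show ?thesis using False le[of r l] r by simp
      qed
    qed
    also have "\<dots> = 2 ^ r / 2 + real (card {l. l < 2 ^ r \<and> 2 ^ r - m < l})"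
      by (simp add: sum.distrib sum_of_bool_eq Int_def)
    also have "real (card {l. l < 2 ^ r \<and> 2 ^ r - m < l}) \<le> real m"
    proof -
      have "{l. l < 2 ^ r \<and> 2 ^ r - m < l} = {2 ^ r - m <..< 2 ^ r}" by auto
      then show ?thesis using big by simp
    qed
    finally have sum: "(\<Sum>i = 1..?N r. ?p i) \<le> 2 ^ r + (2 ^ r / 2 + real m)" by simp
    have N: "real (?N r) = 2 * 2 ^ r - 1" by (simp add: of_nat_diff)
    have "real (4 * m + 4) \<le> real (2 ^ r)" using big by (simp only: of_nat_le_iff)
    then have "4 * real m + 4 \<le> 2 ^ r" by simp
    moreover have "x + (x / 2 + real m) \<le> 7 / 8 * (2 * x - 1)" if "4 * real m + 4 \<le> x" for x :: real
      using that by (simp add: field_simps)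
    ultimately have "2 ^ r + (2 ^ r / 2 + real m) \<le> 7 / 8 * real (?N r)" unfolding N by blast
    with sum have "(\<Sum>i = 1..?N r. ?p i) \<le> 7 / 8 * real (?N r)" by linarith
    moreover have "0 < real (?N r)" unfolding N using one_le_power[of "2::real" r] by linarith
    ultimately show ?thesis by (simp only: pos_divide_le_eq)
  qed
  then have "\<forall>r\<ge>Suc (max n (4 * m + 4)). (\<Sum>i = 1..?N r. ?p i) / real (?N r) \<le> 7 / 8"
    by (intro allI impI) (simp only: Suc_le_eq)
  then show ?thesis by (intro LIMSEQ_le_const2[OF lim]) blast
qed

text \<open>Counting, with \<open>s = 2 ^ (n - j)\<close>: there are at most
  \<open>2 * 2 ^ (n * s)\<close> short code words, but at least 7/8 of \<open>k j ^ s\<close> tuples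
  of distinct indices, where \<open>k j\<close> is at least \<open>16 * 2 ^ n\<close>. The short
  words and the loss from repeated indices account for at most 1/4 each.\<close>

lemma short_code_words_le:
  fixes c :: "nat list \<Rightarrow> bool list"
  assumes n: "1 \<le> n" "j \<le> n" "8 * 4 ^ n \<le> k j" and m: "2 ^ (n + 1) \<le> m"
    and inj: "inj_on c (blocks (k 0) m)"
  defines "B \<equiv> {x \<in> blocks (k 0) m. length (c x) \<le> n * 2 ^ (n - j)}"
  shows "measure \<mu> {\<xi> \<in> space \<mu>. stake m \<xi> \<in> B} \<le> 7 / 8"
proof (rule mean_le_of_inside_le)
  show finB: "finite B" unfolding B_def by (rule finite_subset[OF _ finite_blocks]) auto
  show "length x = m" if "x \<in> B" for x using that by (simp add: B_def blocks_def)
  fix r l assume r: "n < r" "l + m \<le> 2 ^ r"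
  define s where "s = (2::nat) ^ (n - j)"
  have s1: "1 \<le> s" by (simp add: s_def)
  have s2: "s ^ 2 = 4 ^ (n - j)" by (simp add: s_def power2_eq_square power_mult_distrib[symmetric])
  have "8 * 4 ^ (n - j) \<le> 8 * (4::nat) ^ n" by (simp add: power_increasing)
  then have s3: "8 * s ^ 2 \<le> k j" unfolding s2 using n(3) by linarith
  have "s \<le> s ^ 2" using s1 by (simp add: power2_eq_square)
  then have s4: "s \<le> k j" using s3 by linarith
  have kj: "0 < real (k j)" using k_pos[of j] by simp
  have "real (8 * s ^ 2) \<le> real (k j)" using s3 by (simp only: of_nat_le_iff)
  then have 8: "8 * real s ^ 2 \<le> k j" by simp
  have card_D: "real (card (dlists {1..k j} s)) \<ge> 7 / 8 * real (k j) ^ s"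
  proof -
    have "real s ^ 2 / k j \<le> 1 / 8" using 8 kj by (simp add: pos_divide_le_eq)
    then have "7 / 8 * real (k j) ^ s \<le> (1 - real s ^ 2 / k j) * real (k j) ^ s"
      by (intro mult_right_mono) auto
    also have "\<dots> \<le> card (dlists {1..k j} s)"
      using card_dlists_ge[of "{1..k j}" s] s4 k_pos[of j] by simp
    finally show ?thesis .
  qed
  have "card B \<le> card {w :: bool list. length w \<le> n * s}"
    by (rule card_inj_on_le[of c]) (use inj finite_card_short_bool_lists in \<open>auto simp: B_def s_def intro: inj_on_subset\<close>)
  also have "\<dots> \<le> 2 ^ Suc (n * s)" by (rule finite_card_short_bool_lists)
  finally have "real (card B) \<le> real (2 ^ Suc (n * s))" by (simp only: of_nat_le_iff)
  then have "real (card B) \<le> 2 * 2 ^ (n * s)" by simp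
  moreover have "16 * 2 ^ (n * s) \<le> real (k j) ^ s"
  proof -
    have "(16::real) ^ 1 * 2 ^ (n * s) \<le> 16 ^ s * (2 ^ n) ^ s"
      unfolding power_mult by (intro mult_right_mono power_increasing) (use s1 in auto)
    also have "\<dots> = (16 * 2 ^ n) ^ s" by (simp add: power_mult_distrib)
    also have "\<dots> \<le> real (k j) ^ s"
    proof (rule power_mono)
      have "(2::nat) ^ 1 \<le> 2 ^ n" using n(1) by (intro power_increasing) auto
      then have "16 * 2 ^ n \<le> 8 * ((2::nat) ^ n * 2 ^ n)" by simp
      also have "(2::nat) ^ n * 2 ^ n = 4 ^ n" by (simp add: power_mult_distrib[symmetric])
      finally have "16 * 2 ^ n \<le> k j" using n(3) by linarith
      then have "real (16 * 2 ^ n) \<le> real (k j)" by (simp only: of_nat_le_iff)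
      then show "16 * 2 ^ n \<le> real (k j)" by simp
    qed simp
    finally show ?thesis by simp
  qed
  ultimately have "real (card B) \<le> 1 / 4 * card (dlists {1..k j} s)" using card_D by linarith
  moreover have "0 < real (card (dlists {1..k j} s))"
    using card_dlists_pos[of "{1..k j}" s] s4 by simp
  ultimately have "card B / card (dlists {1..k j} s) \<le> 1 / 4" by (simp add: pos_divide_le_eq)
  moreover have "2 * 4 ^ (n - j) / k j \<le> 1 / 4"
  proof -
    have "real (s ^ 2) = 4 ^ (n - j)" unfolding s2 by simp
    then have "8 * 4 ^ (n - j) \<le> real (k j)" using 8 by simp
    then show ?thesis using kj by (simp add: pos_divide_le_eq)
  qed
  ultimately show "measure \<Omega> {\<omega>. rha_block \<omega> (2 ^ r + l) m \<in> B} \<le> 1 / 2"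
    using prob_block_le[OF r(1) m r(2) n(2) s4[unfolded s_def] finB] unfolding s_def by linarith
qed

end

section \<open>From code lengths to the expected ratio\<close>

context rha_ergodic
begin

text \<open>The tower property: the defining equation of \<open>F\<close> with the whole space as
  \<open>B\<close> shows that \<open>F\<close> averages to \<mu> on each cylinder, and a function of
  \<open>m\<close> letters is a finite combination of cylinders.\<close>

lemma nn_integral_stake_F:
  fixes f :: "nat list \<Rightarrow> real"
  assumes f: "\<And>x. 0 \<le> f x"
  shows "(\<integral>\<^sup>+ \<omega>. ennreal (\<integral>\<xi>. f (stake m \<xi>) \<partial>F \<omega>) \<partial>\<mu>)
    = ennreal (\<Sum>x\<in>blocks (k 0) m. f x * measure \<mu> {\<xi> \<in> space \<mu>. stake m \<xi> = x})"
proof -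
  let ?A = "\<lambda>x. {\<xi> \<in> space \<mu>. stake m \<xi> = x}"
  have A: "?A x \<in> sets \<mu>" for x using sets_stake_mu[of m "{x}"] by simp
  have sp: "space (F \<omega>) = space \<mu>" if "\<omega> \<in> space \<mu>" for \<omega>
    using sets_eq_imp_space_eq[OF sets_F[OF that]] sets_eq_imp_space_eq[OF sets_mu] by simp
  have int: "integrable \<mu> (\<lambda>\<omega>. measure (F \<omega>) (?A x))" for x
    by (rule mu.integrable_const_bound[of _ 1])
      (use measurable_F[OF A] prob_space.prob_le_1[OF prob_space_F] in \<open>auto intro!: AE_I2\<close>)
  have eq: "(\<integral>\<omega>. measure (F \<omega>) (?A x) \<partial>\<mu>) = measure \<mu> (?A x)" for x
  proof -
    have "space \<mu> = space (invariant_sets \<mu>)"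
      unfolding invariant_sets_def by (rule space_measure_of[symmetric]) (auto dest: sets.sets_into_space)
    then have "space \<mu> \<in> sets (invariant_sets \<mu>)" by (metis sets.top)
    from integral_F[OF A this] have "(\<integral>\<omega>. indicator (space \<mu>) \<omega> * measure (F \<omega>) (?A x) \<partial>\<mu>) = measure \<mu> (?A x)"
      using sets.sets_into_space[OF A] by (simp add: Int_absorb2)
    then show ?thesis by (simp cong: Bochner_Integration.integral_cong)
  qed
  have "(\<integral>\<^sup>+ \<omega>. ennreal (\<integral>\<xi>. f (stake m \<xi>) \<partial>F \<omega>) \<partial>\<mu>)
      = (\<integral>\<^sup>+ \<omega>. ennreal (\<Sum>x\<in>blocks (k 0) m. f x * measure (F \<omega>) (?A x)) \<partial>\<mu>)"
    by (rule nn_integral_cong)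
      (simp add: integral_stake[OF prob_space_F sets_F] sp)
  also have "\<dots> = ennreal (\<integral>\<omega>. (\<Sum>x\<in>blocks (k 0) m. f x * measure (F \<omega>) (?A x)) \<partial>\<mu>)"
    by (rule nn_integral_eq_integral) (auto intro!: Bochner_Integration.integrable_sum AE_I2 sum_nonneg mult_nonneg_nonneg f int)
  also have "(\<integral>\<omega>. (\<Sum>x\<in>blocks (k 0) m. f x * measure (F \<omega>) (?A x)) \<partial>\<mu>)
      = (\<Sum>x\<in>blocks (k 0) m. f x * measure \<mu> (?A x))"
    using int by (simp add: Bochner_Integration.integral_sum eq)
  finally show ?thesis .
qed

text \<open>Almost every component has entropy at most the constant \<open>H\<close>, so its ratio
  is at least its code length over \<open>H\<close>, trivially so where the ratio is infinite. The
  average of these code lengths is the one under \<mu>, where the length exceeds \<open>L\<close>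
  with probability at least 1/8.\<close>

lemma nn_integral_ratio_ge:
  assumes n: "1 \<le> n" "j \<le> n" "8 * 4 ^ n \<le> k j" and m: "2 ^ (n + 1) \<le> m" "m \<le> 2 ^ (n + 2)"
    and inj: "inj_on (C m) (blocks (k 0) m)"
  shows "ennreal (real n * 2 ^ (n - j) / 8 / log 2 (2 ^ (n + 2) * real (k (n + 2)) ^ 2))
    \<le> (\<integral>\<^sup>+ \<omega>. ratio_inf (exp_code_length (F \<omega>) C m) (block_entropy (F \<omega>) m) \<partial>\<mu>)"
proof -
  define H where "H = log 2 (2 ^ (n + 2) * real (k (n + 2)) ^ 2)"
  define L where "L = n * 2 ^ (n - j)"
  let ?B = "{x \<in> blocks (k 0) m. length (C m x) \<le> L}"
  let ?q = "\<lambda>x. measure \<mu> {\<xi> \<in> space \<mu>. stake m \<xi> = x}"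
  \<comment> \<open>The argument of the logarithm is at least 2, which makes \<open>H\<close> a
    positive divisor.\<close>
  have "(2::real) ^ 1 * 1 \<le> 2 ^ (n + 2) * real (k (n + 2)) ^ 2"
    using k_pos[of "n + 2"] by (intro mult_mono power_increasing one_le_power) auto
  then have H: "0 < H" by (simp add: H_def)
  have m0: "0 < m" using m(1) by (metis gr0I le_zero_eq power_eq_0_iff zero_neq_numeral)
  have B: "measure \<mu> {\<xi> \<in> space \<mu>. stake m \<xi> \<in> ?B} \<le> 7 / 8"
    unfolding L_def by (rule short_code_words_le[OF n m(1) inj])
  have "measure \<mu> {\<xi> \<in> space \<mu>. stake m \<xi> \<in> ?B} = (\<integral>\<xi>. indicator ?B (stake m \<xi>) \<partial>\<mu>)"
  proof -
    have "(\<integral>\<xi>. indicator ?B (stake m \<xi>) \<partial>\<mu>) = (\<integral>\<xi>. indicator {\<xi> \<in> space \<mu>. stake m \<xi> \<in> ?B} \<xi> \<partial>\<mu> :: real)"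
      by (rule Bochner_Integration.integral_cong) (auto simp: indicator_def)
    then show ?thesis using sets_stake_mu[of m ?B] by simp
  qed
  also have "\<dots> = (\<Sum>x\<in>blocks (k 0) m. indicator ?B x * ?q x)"
    by (rule integral_stake[OF mu.prob_space_axioms sets_mu])
  finally have "1 / 8 \<le> (\<Sum>x\<in>blocks (k 0) m. ?q x) - (\<Sum>x\<in>blocks (k 0) m. indicator ?B x * ?q x)"
    using B sum_prob_stake[OF mu.prob_space_axioms sets_mu, of m] by linarith
  then have "real L * (1 / 8) \<le> real L * (\<Sum>x\<in>blocks (k 0) m. (1 - indicator ?B x) * ?q x)"
    by (intro mult_left_mono) (simp_all add: sum_subtractf left_diff_distrib)
  also have "\<dots> = (\<Sum>x\<in>blocks (k 0) m. real L * ((1 - indicator ?B x) * ?q x))"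
    by (rule sum_distrib_left)
  also have "\<dots> \<le> (\<Sum>x\<in>blocks (k 0) m. real (length (C m x)) * ?q x)"
    by (rule sum_mono) (auto simp: indicator_def intro!: mult_right_mono)
  finally have L: "real L / 8 \<le> (\<Sum>x\<in>blocks (k 0) m. real (length (C m x)) * ?q x)" by simp
  have "ennreal (real L / 8 / H) \<le> ennreal ((\<Sum>x\<in>blocks (k 0) m. real (length (C m x)) * ?q x) / H)"
    by (intro ennreal_leI divide_right_mono L) (use H in simp)
  also have "\<dots> = (\<integral>\<^sup>+ \<omega>. ennreal (\<integral>\<xi>. real (length (C m (stake m \<xi>))) / H \<partial>F \<omega>) \<partial>\<mu>)"
    using nn_integral_stake_F[of "\<lambda>x. real (length (C m x)) / H" m] H by (simp add: sum_divide_distrib)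
  also have "\<dots> = (\<integral>\<^sup>+ \<omega>. ennreal (exp_code_length (F \<omega>) C m / H) \<partial>\<mu>)"
    by (simp add: exp_code_length_def)
  also have "\<dots> \<le> (\<integral>\<^sup>+ \<omega>. ratio_inf (exp_code_length (F \<omega>) C m) (block_entropy (F \<omega>) m) \<partial>\<mu>)"
  proof (rule nn_integral_mono_AE)
    show "AE \<omega> in \<mu>. ennreal (exp_code_length (F \<omega>) C m / H)
        \<le> ratio_inf (exp_code_length (F \<omega>) C m) (block_entropy (F \<omega>) m)"
      using AE_block_entropy_le[OF m0 m(2)] AE_space
    proof eventually_elim
      case (elim \<omega>)
      let ?a = "exp_code_length (F \<omega>) C m" and ?h = "block_entropy (F \<omega>) m"
      have a: "0 \<le> ?a" unfolding exp_code_length_def by simp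
      have h: "0 \<le> ?h" by (rule block_entropy_nonneg[OF prob_space_F[OF elim(2)] sets_F[OF elim(2)]])
      have hH: "?h \<le> H" using elim(1) by (simp add: H_def)
      show ?case
      proof (cases "?h = 0")
        case False
        then have "?a / H \<le> ?a / ?h" using a h hH by (intro divide_left_mono) auto
        then show ?thesis using False by (simp add: ratio_inf_def ennreal_leI)
      qed (simp add: ratio_inf_def)
    qed
  qed
  finally show ?thesis by (simp add: L_def H_def)
qed

end

section \<open>Asymptotics\<close>

theorem theorem7:
  fixes \<beta> :: real and k :: "nat \<Rightarrow> nat"
    and \<mu> :: "nat stream measure" and F :: "nat stream \<Rightarrow> nat stream measure"
    and C :: "nat \<Rightarrow> nat list \<Rightarrow> bool list"
  assumes "0 < \<beta>" and "\<beta> < 1"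
    and k_def: "\<And>n. k n = nat \<lfloor>exp (2 powr (\<beta> * real n))\<rfloor>"
    and k_growth: "\<And>n. n \<ge> 1 \<Longrightarrow> k (n - 1) \<le> k n \<and> k n \<le> k (n - 1) ^ 2"
    and mu: "is_stationary_mean k \<mu>"
    and F: "is_reg_cond_prob \<mu> (invariant_sets \<mu>) F"
    and C: "ud_block_code (k 0) C"
  shows "\<exists>c > 0. \<forall>\<^sub>F m in sequentially.
           ennreal (c * (real m powr (1 - \<beta>) / ln (real m) powr (1 / \<beta> - 1)))
             \<le> (\<integral>\<^sup>+ \<omega>. ratio_inf (exp_code_length (F \<omega>) C m) (block_entropy (F \<omega>) m) \<partial>\<mu>)"
proof -
  have k_lower: "exp (2 powr (\<beta> * real n)) - 1 \<le> real (k n)" and k_upper: "real (k n) \<le> exp (2 powr (\<beta> * real n))" for n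
  proof -
    have "0 \<le> \<lfloor>exp (2 powr (\<beta> * real n))\<rfloor>" by simp
    then have "real (k n) = of_int \<lfloor>exp (2 powr (\<beta> * real n))\<rfloor>" unfolding k_def by (simp only: of_nat_nat)
    then show "exp (2 powr (\<beta> * real n)) - 1 \<le> real (k n)" "real (k n) \<le> exp (2 powr (\<beta> * real n))"
      by linarith+
  qed
  have k_pos: "0 < k n" for n
  proof -
    have "1 < exp (2 powr (\<beta> * real n))" by simp
    then show ?thesis using k_lower[of n] by (cases "k n") auto
  qed
  interpret rha_ergodic k \<mu> F
    by unfold_locales (use k_pos k_growth[of "Suc _"] mu F in auto)

  \<comment> \<open>272 = 2 * 8 * 17: rounding \<open>j\<close> up costs 2, the probability of a
    long code word 8, the entropy bound 17. The second divisor comes from comparing \<open>m\<close>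
    with \<open>2 ^ n\<close>.\<close>
  define c where "c = 1 / (272 * 3 powr (1 / \<beta>)) / (4 * 2 powr (1 / \<beta> - 1))"
  have c: "0 < c" by (simp add: c_def)
  \<comment> \<open>Three conditions on \<open>n\<close> are collected: this one absorbs the linear
    term of the entropy bound, the next one gives \<open>j <= n\<close>, and \<open>4 <= n\<close>
    serves the lower bound on \<open>k j\<close>.\<close>
  have "\<forall>\<^sub>F n in sequentially. real n + 2 \<le> 2 powr (\<beta> * real n)"
    using \<open>0 < \<beta>\<close> by real_asymp
  moreover have "\<forall>\<^sub>F n in sequentially. 2 * (3 * real n) powr (1 / \<beta>) \<le> 2 ^ n"
    using \<open>0 < \<beta>\<close> by real_asymp
  ultimately have "\<forall>\<^sub>F n in sequentially. real n + 2 \<le> 2 powr (\<beta> * real n)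
      \<and> 2 * (3 * real n) powr (1 / \<beta>) \<le> 2 ^ n \<and> 4 \<le> n"
    using eventually_ge_at_top[of 4] by eventually_elim simp
  then obtain n0 where n0: "real n + 2 \<le> 2 powr (\<beta> * real n)"
      "2 * (3 * real n) powr (1 / \<beta>) \<le> 2 ^ n" "4 \<le> n" if "n0 \<le> n" for n
    unfolding eventually_sequentially by blast
  have main: "ennreal (c * (real m powr (1 - \<beta>) / ln (real m) powr (1 / \<beta> - 1)))
      \<le> (\<integral>\<^sup>+ \<omega>. ratio_inf (exp_code_length (F \<omega>) C m) (block_entropy (F \<omega>) m) \<partial>\<mu>)"
    if m: "2 ^ (n0 + 1) \<le> m" for m
  proof -
    have "(1::nat) \<le> 2 ^ (n0 + 1)" by simp
    then have "1 \<le> m" using m by linarith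
    then obtain n' where n': "2 ^ n' \<le> m" "m < 2 ^ (n' + 1)"
      using ex_power_ivl1[of 2 m] by auto
    have "(2::nat) ^ (n0 + 1) < 2 ^ (n' + 1)" using m n'(2) by linarith
    then have "n0 < n'" using power_less_imp_less_exp[of "2::nat" "n0 + 1" "n' + 1"] by simp
    \<comment> \<open>The level is one below the binary logarithm of \<open>m\<close>: low enough
      for the window to contain an aligned string of level \<open>n\<close>, high enough for strings
      of level \<open>n + 2\<close> to be at least as long as the window.\<close>
    then obtain n where n: "n' = n + 1" "n0 \<le> n" by (cases n') auto
    note big = n0[OF n(2)]
    have m1: "2 ^ (n + 1) \<le> m" and m2: "m < 2 ^ (n + 2)" using n' by (simp_all add: n(1))

    \<comment> \<open>The solution of 2^(\<beta> a) = 3 n, so that \<open>k j\<close> is at least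
      about exp (3 n), which beats 4^n with a margin.\<close>
    define a where "a = log 2 (3 * real n) / \<beta>"
    define j where "j = nat \<lceil>a\<rceil>"
    have "1 \<le> 3 * real n" using big(3) by simp
    then have a: "0 \<le> a" unfolding a_def using \<open>0 < \<beta>\<close> by (intro divide_nonneg_pos) auto
    have j1: "a \<le> real j" and j2: "real j \<le> a + 1"
      using a of_int_ceiling_le_add_one[of a] le_of_int_ceiling[of a] by (simp_all add: j_def)
    have twoa: "2 powr a = (3 * real n) powr (1 / \<beta>)"
    proof -
      have "2 powr a = (2 powr log 2 (3 * real n)) powr (1 / \<beta>)"
        unfolding powr_powr by (simp add: a_def)
      also have "2 powr log 2 (3 * real n) = 3 * real n" using big(3) by simp
      finally show ?thesis .
    qed
    have twoj: "2 ^ j \<le> 2 * (3 * real n) powr (1 / \<beta>)"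
    proof -
      have "2 ^ j = 2 powr real j" by (simp add: powr_realpow)
      also have "\<dots> \<le> 2 powr (a + 1)" using j2 by simp
      also have "\<dots> = 2 * (3 * real n) powr (1 / \<beta>)" by (simp add: powr_add twoa)
      finally show ?thesis .
    qed
    then have "(2::real) ^ j \<le> 2 ^ n" using big(2) by linarith
    then have jn: "j \<le> n" by simp
    have kj: "8 * 4 ^ n \<le> k j"
    proof -
      have "3 * real n = 2 powr (\<beta> * a)" using big(3) \<open>0 < \<beta>\<close> by (simp add: a_def)
      also have "\<dots> \<le> 2 powr (\<beta> * real j)" using j1 \<open>0 < \<beta>\<close> by simp
      finally have 1: "exp (3 * real n) \<le> exp (2 powr (\<beta> * real j))" by simp
      have "(2::real) ^ (3 * n) \<le> exp 1 ^ (3 * n)"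
        by (rule power_mono) (use exp_ge_add_one_self[of 1] in auto)
      also have "\<dots> = exp (3 * real n)" by (simp add: exp_of_nat_mult[symmetric])
      finally have 2: "(8::real) ^ n \<le> exp (3 * real n)" by (simp add: power_mult)
      \<comment> \<open>The factor 16 instead of 8 pays for the 1 lost in the floor of
        \<open>k j\<close>.\<close>
      have "(2::real) ^ 4 \<le> 2 ^ n" using big(3) by (intro power_increasing) auto
      then have "16 * (4::real) ^ n \<le> 2 ^ n * 4 ^ n" by (intro mult_right_mono) auto
      also have "\<dots> = 8 ^ n" by (simp add: power_mult_distrib[symmetric])
      finally have "16 * 4 ^ n - 1 \<le> real (k j)" using 1 2 k_lower[of j] by linarith
      moreover have "(1::real) \<le> 4 ^ n" by simp
      ultimately have "8 * 4 ^ n \<le> real (k j)" by linarith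
      then have "real (8 * 4 ^ n) \<le> real (k j)" by simp
      then show ?thesis by (simp only: of_nat_le_iff)
    qed

    define H where "H = log 2 (2 ^ (n + 2) * real (k (n + 2)) ^ 2)"
    have "(2::real) ^ 1 * 1 \<le> 2 ^ (n + 2) * real (k (n + 2)) ^ 2"
      using k_pos[of "n + 2"] by (intro mult_mono power_increasing one_le_power) auto
    then have H0: "0 < H" by (simp add: H_def)
    \<comment> \<open>17 = 1 + 2 * 8: the term \<open>n + 2\<close> costs 1; the square doubles
      \<open>ln (k (n + 2)) / ln 2\<close>, where the two extra levels cost at most 2^(2 \<beta>) <=
      4 and \<open>1 / ln 2\<close> at most 2.\<close>
    have H: "H \<le> 17 * 2 powr (\<beta> * real n)"
    proof -
      have kp: "0 < real (k (n + 2))" using k_pos by simp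
      have H_eq: "H = log 2 (2 ^ (n + 2)) + log 2 (real (k (n + 2)) ^ 2)"
        unfolding H_def by (rule log_mult_pos) (use kp in simp_all)
      have log_two: "log 2 (2 ^ (n + 2)) = real n + 2"
        by (subst log_pow_cancel) simp_all
      have log_k: "log 2 (real (k (n + 2)) ^ 2) = 2 * (ln (real (k (n + 2))) / ln 2)"
        using log_nat_power[OF less_imp_le[OF kp], of 2 2] by (simp add: log_def)
      have "H = (real n + 2) + 2 * (ln (real (k (n + 2))) / ln 2)"
        by (simp only: H_eq log_two log_k)
      moreover have "ln (real (k (n + 2))) \<le> 4 * 2 powr (\<beta> * real n)"
      proof -
        have "ln (real (k (n + 2))) \<le> ln (exp (2 powr (\<beta> * real (n + 2))))"
          by (rule ln_mono[OF k_upper kp])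
        also have "\<dots> = 2 powr (\<beta> * real (n + 2))" by (rule ln_exp)
        also have "\<dots> = 2 powr (\<beta> * real n) * 2 powr (2 * \<beta>)"
          by (simp add: powr_add[symmetric] algebra_simps)
        also have "\<dots> \<le> 2 powr (\<beta> * real n) * 2 powr 2"
          using \<open>\<beta> < 1\<close> by (intro mult_left_mono powr_mono) auto
        finally show ?thesis by simp
      qed
      then have "ln (real (k (n + 2))) / ln 2 \<le> 4 * 2 powr (\<beta> * real n) / (1 / 2)"
        using ln2_ge_two_thirds by (intro frac_le) auto
      moreover have "a + 2 * q \<le> 17 * x" if "a \<le> x" "q \<le> 4 * x / (1 / 2)" for a q x :: real
        using that by simp
      ultimately show ?thesis using big(1) by blast
    qed

    \<comment> \<open>The common order of magnitude, written in terms of \<open>n\<close>: the bound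
      from the code lies above a multiple of \<open>P\<close>, the claimed rate in \<open>m\<close>
      below another one.\<close>
    define P where "P = real n powr (1 - 1 / \<beta>) * 2 powr ((1 - \<beta>) * real n)"
    have P: "0 < P" using big(3) by (simp add: P_def)
    have low: "P / (272 * 3 powr (1 / \<beta>)) \<le> real n * 2 ^ (n - j) / 8 / H"
    proof -
      have npos: "0 < real n" using big(3) by simp
      have "P / (272 * 3 powr (1 / \<beta>))
          = real n * (2 ^ n / (2 * (3 * real n) powr (1 / \<beta>))) / 8 / (17 * 2 powr (\<beta> * real n))"
        using npos by (simp add: P_def powr_mult powr_diff left_diff_distrib powr_realpow)
      also have "\<dots> \<le> real n * (2 ^ n / 2 ^ j) / 8 / (17 * 2 powr (\<beta> * real n))"
        using twoj npos by (intro divide_right_mono mult_left_mono divide_left_mono mult_pos_pos) auto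
      also have "\<dots> = real n * 2 ^ (n - j) / 8 / (17 * 2 powr (\<beta> * real n))"
        using jn by (simp add: power_diff)
      also have "\<dots> \<le> real n * 2 ^ (n - j) / 8 / H"
        using H H0 by (intro divide_left_mono) auto
      finally show ?thesis .
    qed
    have up: "real m powr (1 - \<beta>) / ln (real m) powr (1 / \<beta> - 1) \<le> P * (4 * 2 powr (1 / \<beta> - 1))"
    proof -
      have npos: "0 < real n" using big(3) by simp
      have "real m \<le> real (2 ^ (n + 2))" using m2 by (simp only: of_nat_le_iff)
      then have "real m powr (1 - \<beta>) \<le> real (2 ^ (n + 2)) powr (1 - \<beta>)"
        using \<open>\<beta> < 1\<close> by (intro powr_mono2) auto
      also have "real (2 ^ (n + 2)) = 2 powr real (n + 2)" by (simp only: powr_realpow of_nat_power of_nat_numeral)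
      also have "(2 powr real (n + 2)) powr (1 - \<beta>) = 2 powr ((1 - \<beta>) * real n) * 2 powr (2 * (1 - \<beta>))"
        by (simp add: powr_powr powr_add[symmetric] algebra_simps)
      also have "\<dots> \<le> 2 powr ((1 - \<beta>) * real n) * 2 powr 2"
        using \<open>0 < \<beta>\<close> by (intro mult_left_mono powr_mono) auto
      finally have 1: "real m powr (1 - \<beta>) \<le> 4 * 2 powr ((1 - \<beta>) * real n)" by simp
      have "real (2 ^ n) \<le> real m"
      proof -
        have "(2::nat) ^ n \<le> 2 ^ (n + 1)" by simp
        then have "2 ^ n \<le> m" using m1 by linarith
        then show ?thesis by (simp only: of_nat_le_iff)
      qed
      then have "ln (2 ^ n) \<le> ln (real m)" by (intro ln_mono) auto
      moreover have "real n * (1 / 2) \<le> real n * ln 2"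
        using ln2_ge_two_thirds by (intro mult_left_mono) auto
      ultimately have "real n / 2 \<le> ln (real m)" by (simp add: ln_realpow)
      then have 2: "(real n / 2) powr (1 / \<beta> - 1) \<le> ln (real m) powr (1 / \<beta> - 1)"
        using \<open>\<beta> < 1\<close> \<open>0 < \<beta>\<close> by (intro powr_mono2) auto
      have "real m powr (1 - \<beta>) / ln (real m) powr (1 / \<beta> - 1)
          \<le> (4 * 2 powr ((1 - \<beta>) * real n)) / (real n / 2) powr (1 / \<beta> - 1)"
        by (rule frac_le[OF _ 1 _ 2]) (use npos in auto)
      also have "\<dots> = P * (4 * 2 powr (1 / \<beta> - 1))"
        using npos by (simp add: P_def powr_divide powr_diff)
      finally show ?thesis .
    qed
    have "c * (real m powr (1 - \<beta>) / ln (real m) powr (1 / \<beta> - 1)) \<le> c * (P * (4 * 2 powr (1 / \<beta> - 1)))"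
      using up c by (intro mult_left_mono) auto
    also have "\<dots> = P / (272 * 3 powr (1 / \<beta>))" by (simp add: c_def)
    also have "\<dots> \<le> real n * 2 ^ (n - j) / 8 / H" by (rule low)
    finally have "ennreal (c * (real m powr (1 - \<beta>) / ln (real m) powr (1 / \<beta> - 1)))
        \<le> ennreal (real n * 2 ^ (n - j) / 8 / H)"
      by (rule ennreal_leI)
    also have "\<dots> \<le> (\<integral>\<^sup>+ \<omega>. ratio_inf (exp_code_length (F \<omega>) C m) (block_entropy (F \<omega>) m) \<partial>\<mu>)"
      unfolding H_def
      by (rule nn_integral_ratio_ge[OF _ jn kj m1]) (use big(3) m2 C in \<open>auto simp: ud_block_code_def\<close>)
    finally show ?thesis .
  qed
  show ?thesis
    using c main by (intro exI[of _ c]) (auto simp: eventually_sequentially)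
qed

end
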